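(* Let $\Omega\subset\mathbb H^n$ be an open, horizontally bounded and $H$-convex set, and let $u,v:\Omega\to\mathbb R$ be $H$-convex functions. Let $\Omega_0\subset\mathbb H^n$ be an open set with $\overline{\Omega_0}\subset\Omega$, and assume that $u<v$ in $\Omega_0$ and $u=v$ on $\partial\Omega_0$. Then $\partial_H v(\Omega_0)\subset\partial_H u(\Omega_0)$.
   Context: $\mathbb H^n=\mathbb C^n\times\mathbb R\cong\mathbb R^{2n+1}$ with real coordinates $(x,y,t)$, $z=x+iy\in\mathbb C^n$, and group law $(z,t)\circ(z',t')=(z+z',t+t'+2\,\mathrm{Im}\langle z,z'\rangle)$, where $\langle z,z'\rangle=\sum_{j=1}^n z_j\overline{z'_j}$. Dilations: $\delta_\lambda(z,t)=(\lambda z,\lambda^2t)$. The horizontal plane at $\xi_0=(x_0,y_0,t_0)$ is $H_{\xi_0}=\{(x,y,t): t=t_0+2(x\cdot y_0-x_0\cdot y)\}$. $\mathrm{Pr}_1(x,y,t)=(x,y)\in\mathbb R^{2n}$. Gauge $N(z,t)=(|z|^4+t^2)^{1/4}$, metric $d_H(\xi,\zeta)=N(\zeta^{-1}\circ\xi)$, with the associated diameter $\mathrm{diam}_H$. A set $\tilde\Omega$ is $H$-convex if for all $\xi_1,\xi_2\in\tilde\Omega$ with $\xi_1\in H_{\xi_2}$ and all $\lambda\in[0,1]$, $\xi_1\circ\delta_\lambda(\xi_1^{-1}\circ\xi_2)\in\tilde\Omega$; a function $u$ on an $H$-convex set $\tilde\Omega$ is $H$-convex if for all such $\xi_1,\xi_2,\lambda$,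 $u(\xi_1\circ\delta_\lambda(\xi_1^{-1}\circ\xi_2))\le(1-\lambda)u(\xi_1)+\lambda u(\xi_2)$. An open set $\Omega$ is horizontally bounded if $\sup\{\mathrm{diam}_H(\Omega\cap H_\xi):\xi\in\Omega\}<\infty$. For $u:\Omega\to\mathbb R$ and $\xi_0\in\Omega$, the horizontal subdifferential is $\partial_Hu(\xi_0)=\{p\in\mathbb R^{2n}: u(\xi)\ge u(\xi_0)+p\cdot(\mathrm{Pr}_1(\xi)-\mathrm{Pr}_1(\xi_0))\ \forall\xi\in\Omega\cap H_{\xi_0}\}$, and for $E\subset\Omega$, $\partial_Hu(E)=\bigcup_{\xi\in E}\partial_Hu(\xi)$. Here both $\partial_Hu$ and $\partial_Hv$ are computed with respect to the domain $\Omega$. *)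

theory Defs
  imports "HOL-Analysis.Analysis"
begin

text \<open>Points of the Heisenberg group: ((x, y), t) with x, y in R^n, t in R.
  The topology is the Euclidean one of R^(2n+1).\<close>
type_synonym 'n heis = "((real^'n) \<times> (real^'n)) \<times> real"

definition hx :: "'n::finite heis \<Rightarrow> real^'n" where "hx p = fst (fst p)"
definition hy :: "'n::finite heis \<Rightarrow> real^'n" where "hy p = snd (fst p)"
definition ht :: "'n::finite heis \<Rightarrow> real" where "ht p = snd p"

definition Pr1 :: "'n::finite heis \<Rightarrow> (real^'n) \<times> (real^'n)" where "Pr1 p = fst p"

text \<open>Im <z,z'> = sum_j (y_j x'_j - x_j y'_j), for z = x + iy, z' = x' + iy'.\<close>
definition im_herm :: "(real^'n) \<times> (real^'n) \<Rightarrow> (real^'n) \<times> (real^'n) \<Rightarrow> real" where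
  "im_herm z w = snd z \<bullet> fst w - fst z \<bullet> snd w"

definition hmult :: "'n::finite heis \<Rightarrow> 'n heis \<Rightarrow> 'n heis" (infixl "\<circ>\<^sub>H" 70) where
  "hmult p q = (fst p + fst q, snd p + snd q + 2 * im_herm (fst p) (fst q))"

definition hinv :: "'n::finite heis \<Rightarrow> 'n heis" where
  "hinv p = (- fst p, - snd p)"

definition hdil :: "real \<Rightarrow> 'n::finite heis \<Rightarrow> 'n heis" where
  "hdil r p = (r *\<^sub>R fst p, r\<^sup>2 * snd p)"

definition hplane :: "'n::finite heis \<Rightarrow> 'n heis set" where
  "hplane p0 = {p. ht p = ht p0 + 2 * (hx p \<bullet> hy p0 - hx p0 \<bullet> hy p)}"

definition gaugeN :: "'n::finite heis \<Rightarrow> real" where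
  "gaugeN p = ((norm (fst p))^4 + (snd p)\<^sup>2) powr (1/4)"

definition dH :: "'n::finite heis \<Rightarrow> 'n heis \<Rightarrow> real" where
  "dH p q = gaugeN (hinv q \<circ>\<^sub>H p)"

definition diamH :: "'n::finite heis set \<Rightarrow> ereal" where
  "diamH S = (SUP pq \<in> S \<times> S. ereal (dH (fst pq) (snd pq)))"

definition horiz_bounded :: "'n::finite heis set \<Rightarrow> bool" where
  "horiz_bounded \<Omega> \<longleftrightarrow> (SUP p \<in> \<Omega>. diamH (\<Omega> \<inter> hplane p)) < \<infinity>"

definition hconvex_set :: "'n::finite heis set \<Rightarrow> bool" where
  "hconvex_set S \<longleftrightarrow> (\<forall>p1\<in>S. \<forall>p2\<in>S. p1 \<in> hplane p2 \<longrightarrow>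
      (\<forall>r\<in>{0..1}. p1 \<circ>\<^sub>H hdil r (hinv p1 \<circ>\<^sub>H p2) \<in> S))"

definition hconvex_fun :: "'n::finite heis set \<Rightarrow> ('n heis \<Rightarrow> real) \<Rightarrow> bool" where
  "hconvex_fun S u \<longleftrightarrow> (\<forall>p1\<in>S. \<forall>p2\<in>S. p1 \<in> hplane p2 \<longrightarrow>
      (\<forall>r\<in>{0..1}. u (p1 \<circ>\<^sub>H hdil r (hinv p1 \<circ>\<^sub>H p2)) \<le> (1 - r) * u p1 + r * u p2))"

definition hsubdiff :: "'n::finite heis set \<Rightarrow> ('n heis \<Rightarrow> real) \<Rightarrow> 'n heis
     \<Rightarrow> ((real^'n) \<times> (real^'n)) set" where
  "hsubdiff \<Omega> u p0 = {p. \<forall>q \<in> \<Omega> \<inter> hplane p0. u q \<ge> u p0 + p \<bullet> (Pr1 q - Pr1 p0)}"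

definition hsubdiff_set :: "'n::finite heis set \<Rightarrow> ('n heis \<Rightarrow> real) \<Rightarrow> 'n heis set
     \<Rightarrow> ((real^'n) \<times> (real^'n)) set" where
  "hsubdiff_set \<Omega> u E = (\<Union>p\<in>E. hsubdiff \<Omega> u p)"

end

theory Submission
  imports Defs
begin

text \<open>Subtracting the linear function given by a slope P in the subdifferential of v at \<xi>, one may take
  P = 0. On the frontier of \<Omega>0 in the horizontal plane of \<xi> one has u = v \<ge> v \<xi> > u \<xi>, so \<xi> is a
  horizontal descent target for u at every such point. If no point of \<Omega>0 minimised u on its
  horizontal plane, every point of the (compact) slice of the closure of \<Omega>0 would have such a
  target; averaging targets by a partition of unity gives a continuous map, and at its Brouwer fixed
  point the targets average to the point itself. This contradicts Jensen's inequality for H-convex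
  functions on a horizontal plane. Both the openness of the descent condition and Jensen's inequality
  rest on the continuity of H-convex functions.\<close>

text \<open>Horizontal planes turn with the base point, and this shapes the proof. Minimising over
  the slice of \<Omega>0 by \<open>hplane \<xi>\<close> does not help: at a minimiser \<eta> the
  subdifferential tests \<open>hplane \<eta>\<close>, a different plane as soon as \<eta> differs
  from \<xi>. The point sought must be minimal on its own plane, which is a fixed point condition.
  Targets are recorded by their projections to R^(2n): the point \<open>hlift (h z) a\<close> moves
  with z while a stays put, and projections live in a vector space. Jensen's inequality is not
  immediate, because points of \<open>hplane p\<close> are related to p but in general not to one
  another, and H-convexity says nothing directly about the segments between them. Only averages
  centred at p itself are claimed. Heights enter through one fact: a closed horizontal path over a
  loop of size r can change the height by an amount of order r^2. Vertical bounds, continuity and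
  the error term in Jensen's inequality all come from it.\<close>

section \<open>The symplectic form and lifts to horizontal planes\<close>

lemma bounded_bilinear_im_herm:
  "bounded_bilinear (im_herm :: (real^'n) \<times> (real^'n) \<Rightarrow> (real^'n) \<times> (real^'n) \<Rightarrow> real)"
proof
  show "\<exists>K. \<forall>z w :: (real^'n) \<times> (real^'n). norm (im_herm z w) \<le> norm z * norm w * K"
  proof (intro exI allI)
    fix z w :: "(real^'n) \<times> (real^'n)"
    have "\<bar>snd z \<bullet> fst w\<bar> \<le> norm z * norm w"
      by (rule order_trans[OF Cauchy_Schwarz_ineq2 mult_mono])
        (simp_all add: norm_fst_le[of "fst w" "snd w", simplified] norm_snd_le[of "snd z" "fst z", simplified])
    moreover have "\<bar>fst z \<bullet> snd w\<bar> \<le> norm z * norm w"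
      by (rule order_trans[OF Cauchy_Schwarz_ineq2 mult_mono])
        (simp_all add: norm_fst_le[of "fst z" "snd z", simplified] norm_snd_le[of "snd w" "fst w", simplified])
    ultimately show "norm (im_herm z w) \<le> norm z * norm w * 2"
      by (simp add: im_herm_def)
  qed
qed (simp_all add: im_herm_def algebra_simps)

interpretation im_herm: bounded_bilinear "im_herm :: (real^'n) \<times> (real^'n) \<Rightarrow> (real^'n) \<times> (real^'n) \<Rightarrow> real"
  by (rule bounded_bilinear_im_herm)

lemmas im_herm_simps = im_herm.add_left im_herm.add_right im_herm.diff_left im_herm.diff_right
  im_herm.minus_left im_herm.minus_right im_herm.scaleR_left im_herm.scaleR_right

lemma im_herm_self [simp]: "im_herm z z = 0"
  by (simp add: im_herm_def inner_commute)

lemma im_herm_swap: "im_herm w z = - im_herm z w"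
  by (simp add: im_herm_def inner_commute)

text \<open>Supplies the two non-commuting directions with which horizontal steps produce vertical
  displacement.\<close>

lemma im_herm_nondegenerate:
  obtains e f :: "(real^'n) \<times> (real^'n)" where "im_herm e f = 1"
proof
  fix k :: 'n
  show "im_herm (0, axis k 1) (axis k 1, 0) = (1 :: real)"
    by (simp add: im_herm_def inner_axis_axis)
qed

text \<open>\<open>hplane p\<close> is a graph over R^(2n); this is its parametrisation by the
  projection w, so that horizontal relations become equations between lifts.\<close>

definition hlift :: "'n::finite heis \<Rightarrow> (real^'n) \<times> (real^'n) \<Rightarrow> 'n heis" where
  "hlift p w = (w, snd p + 2 * im_herm (fst p) w)"

lemma fst_hlift [simp]: "fst (hlift p w) = w"
  by (simp add: hlift_def)

lemma hlift_fst [simp]: "hlift p (fst p) = p"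
  by (simp add: hlift_def)

lemma hplane_iff: "q \<in> hplane p \<longleftrightarrow> q = hlift p (fst q)"
  by (cases q) (auto simp: hplane_def hlift_def im_herm_def hx_def hy_def ht_def inner_commute)

lemma hlift_in_hplane [simp]: "hlift p w \<in> hplane p"
  by (simp add: hplane_iff)

lemma hplane_sym: "q \<in> hplane p \<Longrightarrow> p \<in> hplane q"
  by (auto simp: hplane_def)

text \<open>\<open>im_herm\<close> vanishes on parallel vectors, so a horizontal line through p lies
  in the plane of each of its points. The real r is unrestricted; r = 1 expresses the symmetry of
  the horizontal relation.\<close>

lemma hlift_hlift:
  assumes "w = (1 - r) *\<^sub>R fst p + r *\<^sub>R a"
  shows "hlift (hlift p w) a = hlift p a" "hlift (hlift p w) (fst p) = p"
  unfolding assms hlift_def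
  by (auto simp: im_herm_simps im_herm_swap[of a "fst p"] algebra_simps)

lemma tendsto_hlift [tendsto_intros]:
  assumes "(f \<longlongrightarrow> p) F" "(g \<longlongrightarrow> w) F"
  shows "((\<lambda>x. hlift (f x) (g x)) \<longlongrightarrow> hlift p w) F"
  unfolding hlift_def by (intro tendsto_intros im_herm.tendsto assms)

lemma continuous_on_hlift [continuous_intros]:
  assumes "continuous_on S f" "continuous_on S g"
  shows "continuous_on S (\<lambda>x. hlift (f x) (g x))"
  unfolding hlift_def by (intro continuous_intros im_herm.continuous_on assms)

section \<open>H-convexity along horizontal lines\<close>

text \<open>H-convexity seen from the intermediate point. The projections a, \<open>fst m\<close>, b
  are collinear, so the two lifts from m also lie in each other's planes, and the definition applies
  to them. Only the endpoints are assumed to be in S.\<close>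

lemma hconvex_fun_center:
  assumes u: "hconvex_fun S u" and a: "hlift m a \<in> S" and b: "hlift m b \<in> S"
    and r: "0 \<le> r" "r \<le> 1" and m: "fst m = (1 - r) *\<^sub>R a + r *\<^sub>R b"
  shows "u m \<le> (1 - r) * u (hlift m a) + r * u (hlift m b)"
proof -
  define p1 where "p1 = hlift m a"
  define p2 where "p2 = hlift m b"
  have mb: "im_herm (fst m) b = (1 - r) * im_herm a b"
    and ma: "im_herm (fst m) a = - r * im_herm a b"
    unfolding m by (simp_all add: im_herm.add_left im_herm.scaleR_left im_herm_swap[of b a])
  have p2: "p2 = hlift p1 b"
    unfolding p1_def p2_def by (simp add: hlift_def ma mb algebra_simps)
  have "p1 \<in> hplane p2"
    by (rule hplane_sym) (simp add: p2)
  moreover have "p1 \<circ>\<^sub>H hdil r (hinv p1 \<circ>\<^sub>H p2) = m"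
    unfolding p1_def p2_def hmult_def hdil_def hinv_def hlift_def
    by (auto simp: prod_eq_iff m im_herm_simps im_herm_swap[of b a] power2_eq_square algebra_simps)
  ultimately show ?thesis
    using u[unfolded hconvex_fun_def, rule_format, of p1 p2 r] a b r
    by (simp add: p1_def[symmetric] p2_def[symmetric])
qed

lemma hconvex_fun_ray:
  assumes u: "hconvex_fun S u" and p: "p \<in> S" and a: "hlift p a \<in> S"
    and r: "0 \<le> r" "r \<le> 1"
  shows "u (hlift p ((1 - r) *\<^sub>R fst p + r *\<^sub>R a)) \<le> (1 - r) * u p + r * u (hlift p a)"
  using hconvex_fun_center[OF u, of "hlift p ((1 - r) *\<^sub>R fst p + r *\<^sub>R a)" "fst p" a r]
  by (simp add: hlift_hlift p a r)

lemma hconvex_fun_center_le: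
  assumes u: "hconvex_fun S u" and a: "hlift m a \<in> S" and b: "hlift m b \<in> S"
    and m: "fst m \<in> closed_segment a b"
    and "u (hlift m a) \<le> M" "u (hlift m b) \<le> M"
  shows "u m \<le> M"
proof -
  obtain r where r: "0 \<le> r" "r \<le> 1" "fst m = (1 - r) *\<^sub>R a + r *\<^sub>R b"
    using m by (auto simp: closed_segment_def)
  have "u m \<le> (1 - r) * u (hlift m a) + r * u (hlift m b)"
    by (rule hconvex_fun_center[OF u a b r])
  also have "\<dots> \<le> M"
    using r assms by (intro convex_bound_le) auto
  finally show ?thesis .
qed

text \<open>The projection runs affinely along a horizontal segment. This permits the reduction to
  slope 0.\<close>

lemma hconvex_fun_add_linear:
  fixes S :: "'n::finite heis set"
  assumes "hconvex_fun S u"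
  shows "hconvex_fun S (\<lambda>q. u q + P \<bullet> fst q)"
  unfolding hconvex_fun_def
proof (intro ballI impI)
  fix p1 p2 :: "'n heis" and r :: real assume h: "p1 \<in> S" "p2 \<in> S" "p1 \<in> hplane p2" "r \<in> {0..1}"
  define q where "q = p1 \<circ>\<^sub>H hdil r (hinv p1 \<circ>\<^sub>H p2)"
  have "P \<bullet> fst q = (1 - r) * (P \<bullet> fst p1) + r * (P \<bullet> fst p2)"
    by (simp add: q_def hmult_def hdil_def hinv_def inner_add_right inner_diff_right algebra_simps)
  moreover have "u q \<le> (1 - r) * u p1 + r * u p2"
    using assms h unfolding hconvex_fun_def q_def by blast
  ultimately have "u q + P \<bullet> fst q \<le> (1 - r) * (u p1 + P \<bullet> fst p1) + r * (u p2 + P \<bullet> fst p2)"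
    unfolding distrib_left by linarith
  then show "u (p1 \<circ>\<^sub>H hdil r (hinv p1 \<circ>\<^sub>H p2)) + P \<bullet> fst (p1 \<circ>\<^sub>H hdil r (hinv p1 \<circ>\<^sub>H p2))
      \<le> (1 - r) * (u p1 + P \<bullet> fst p1) + r * (u p2 + P \<bullet> fst p2)"
    unfolding q_def .
qed

section \<open>Local upper bounds\<close>

text \<open>A point at height s above (z, t) is the midpoint of a horizontal segment whose endpoints move,
  as s varies, along two fixed horizontal lines; on those lines u is convex.\<close>
lemma hconvex_fun_vertical_bound:
  fixes z :: "(real^'n) \<times> (real^'n)"
  assumes \<Omega>: "open \<Omega>" and u: "hconvex_fun \<Omega> u" and p: "(z, t) \<in> \<Omega>"
  obtains M \<sigma> where "\<sigma> > 0" "\<And>s. \<bar>s\<bar> \<le> \<sigma> \<Longrightarrow> u (z, t + s) \<le> M"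
proof -
  obtain e f :: "(real^'n) \<times> (real^'n)" where ef: "im_herm e f = 1"
    by (rule im_herm_nondegenerate)
  then have fe: "im_herm f e = -1"
    using im_herm_swap[of f e] by simp
  \<comment> \<open>\<open>G (d, a)\<close> is reached from (z, t) by a step d along f and then a
    step a along e. For fixed d it traces a horizontal line, which is what \<open>Glift\<close>
    records.\<close>
  define G where "G = (\<lambda>x :: real \<times> real. hlift (hlift (z, t) (z + fst x *\<^sub>R f)) (z + fst x *\<^sub>R f + snd x *\<^sub>R e))"
  have "continuous_on UNIV G"
    unfolding G_def by (intro continuous_intros)
  then have "open (G -` \<Omega>)"
    by (rule open_vimage[OF \<Omega>])
  moreover have "G (0, 0) = (z, t)"
    by (simp add: G_def hlift_def)
  ultimately obtain \<delta>0 where \<delta>0: "\<delta>0 > 0" "ball (0, 0) \<delta>0 \<subseteq> G -` \<Omega>"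
    using p by (metis open_contains_ball vimageI)
  define \<delta> where "\<delta> = \<delta>0 / 3"
  have \<delta>: "\<delta> > 0"
    using \<delta>0 by (simp add: \<delta>_def)
  have G: "G (d, a) \<in> \<Omega>" if "\<bar>d\<bar> \<le> \<delta>" "\<bar>a\<bar> \<le> \<delta>" for d a
  proof -
    have "norm (d, a) \<le> \<bar>d\<bar> + \<bar>a\<bar>"
      by (metis norm_Pair_le real_norm_def)
    also have "\<dots> < \<delta>0"
      using that \<delta>0(1) by (simp add: \<delta>_def)
    finally have "(d, a) \<in> ball (0, 0) \<delta>0"
      by (simp add: dist_Pair_Pair norm_Pair)
    then show ?thesis
      using \<delta>0(2) by blast
  qed
  define M where "M = Max ((u \<circ> G) ` ({-\<delta>, \<delta>} \<times> {-\<delta>, \<delta>}))"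
  have corner: "u (G (d, a)) \<le> M" if "d \<in> {-\<delta>, \<delta>}" "a \<in> {-\<delta>, \<delta>}" for d a
    unfolding M_def using that by (intro Max_ge) auto
  have Glift: "hlift (G (d, a)) (z + d *\<^sub>R f + b *\<^sub>R e) = G (d, b)" for d a b
    unfolding G_def hlift_def
    by (auto simp: im_herm_simps fe ef im_herm_swap[of e z] im_herm_swap[of f z] algebra_simps)
  have edge: "u (G (d, a)) \<le> M" if d: "d \<in> {-\<delta>, \<delta>}" and a: "\<bar>a\<bar> \<le> \<delta>" for d a
  proof (rule hconvex_fun_center_le[OF u, of _ "z + d *\<^sub>R f + (-\<delta>) *\<^sub>R e" "z + d *\<^sub>R f + \<delta> *\<^sub>R e"], unfold Glift)
    define r where "r = (a + \<delta>) / (2 * \<delta>)"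
    have comb: "x + ((1 - r) * b + r * c) *\<^sub>R e = (1 - r) *\<^sub>R (x + b *\<^sub>R e) + r *\<^sub>R (x + c *\<^sub>R e)" for x b c
      by (simp add: algebra_simps)
    have "a = (1 - r) * (-\<delta>) + r * \<delta>"
      using \<delta> by (simp add: r_def field_simps)
    then have "fst (G (d, a)) = z + d *\<^sub>R f + ((1 - r) * (-\<delta>) + r * \<delta>) *\<^sub>R e"
      by (simp add: G_def)
    also have "\<dots> = (1 - r) *\<^sub>R (z + d *\<^sub>R f + (-\<delta>) *\<^sub>R e) + r *\<^sub>R (z + d *\<^sub>R f + \<delta> *\<^sub>R e)"
      by (rule comb)
    finally have "fst (G (d, a)) = (1 - r) *\<^sub>R (z + d *\<^sub>R f + (-\<delta>) *\<^sub>R e) + r *\<^sub>R (z + d *\<^sub>R f + \<delta> *\<^sub>R e)" .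
    moreover have "0 \<le> r" "r \<le> 1"
      using a \<delta> by (auto simp: r_def field_simps)
    ultimately show "fst (G (d, a)) \<in> closed_segment (z + d *\<^sub>R f + (-\<delta>) *\<^sub>R e) (z + d *\<^sub>R f + \<delta> *\<^sub>R e)"
      unfolding closed_segment_def by blast
  qed (use d \<delta> in \<open>auto intro!: G corner\<close>)
  show ?thesis
  proof (rule that)
    show "2 * \<delta>\<^sup>2 > 0"
      using \<delta> by simp
    fix s :: real assume s: "\<bar>s\<bar> \<le> 2 * \<delta>\<^sup>2"
    \<comment> \<open>Relative to the plane of (z, t), the point \<open>G (d, a)\<close> has extra
      height -2 d a, by \<open>im_herm f e = -1\<close>. Both (-\<delta>, a) and (\<delta>, -a) thus
      gain 2 a \<delta>, which has to equal s; the condition \<bar>a\<bar> \<le> \<delta> then gives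
      the range 2 \<delta>^2.\<close>
    define a where "a = s / (2 * \<delta>)"
    have sa: "s = 2 * a * \<delta>"
      using \<delta> by (simp add: a_def)
    have a: "\<bar>a\<bar> \<le> \<delta>"
      using s \<delta> by (simp add: a_def field_simps power2_eq_square)
    have 1: "hlift (z, t + s) (z + (-\<delta>) *\<^sub>R f + a *\<^sub>R e) = G (-\<delta>, a)"
      and 2: "hlift (z, t + s) (z + \<delta> *\<^sub>R f + (-a) *\<^sub>R e) = G (\<delta>, -a)"
      unfolding G_def hlift_def
      by (auto simp: im_herm_simps sa fe ef im_herm_swap[of e z] im_herm_swap[of f z] algebra_simps)
    show "u (z, t + s) \<le> M"
    proof (rule hconvex_fun_center_le[OF u, of _ "z + (-\<delta>) *\<^sub>R f + a *\<^sub>R e" "z + \<delta> *\<^sub>R f + (-a) *\<^sub>R e"], unfold 1 2)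
      have "z = (1/2) *\<^sub>R (z + (-\<delta>) *\<^sub>R f + a *\<^sub>R e) + (1/2) *\<^sub>R (z + \<delta> *\<^sub>R f + (-a) *\<^sub>R e)"
        by (simp add: algebra_simps flip: scaleR_add_left)
      then show "fst (z, t + s) \<in> closed_segment (z + (-\<delta>) *\<^sub>R f + a *\<^sub>R e) (z + \<delta> *\<^sub>R f + (-a) *\<^sub>R e)"
        unfolding closed_segment_def by (auto intro!: exI[of _ "1/2"])
    qed (use a \<delta> in \<open>auto intro!: G edge\<close>)
  qed
qed

lemma hconvex_fun_vertical_interval_bound:
  assumes \<Omega>: "open \<Omega>" and u: "hconvex_fun \<Omega> u" and I: "compact I" "{z} \<times> I \<subseteq> \<Omega>"
  obtains M where "\<And>t. t \<in> I \<Longrightarrow> u (z, t) \<le> M"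
proof -
  have "\<forall>t\<in>I. \<exists>M \<sigma>. \<sigma> > 0 \<and> (\<forall>s\<in>ball t \<sigma>. u (z, s) \<le> M)"
  proof
    fix t assume "t \<in> I"
    then have "(z, t) \<in> \<Omega>"
      using I(2) by auto
    then obtain M \<sigma> where M: "\<sigma> > 0" "\<And>s. \<bar>s\<bar> \<le> \<sigma> \<Longrightarrow> u (z, t + s) \<le> M"
      using hconvex_fun_vertical_bound[OF \<Omega> u] by metis
    have "u (z, s) \<le> M" if "s \<in> ball t \<sigma>" for s
      using M(2)[of "s - t"] that by (simp add: dist_real_def)
    then show "\<exists>M \<sigma>. \<sigma> > 0 \<and> (\<forall>s\<in>ball t \<sigma>. u (z, s) \<le> M)"
      using M(1) by blast
  qed
  then obtain M \<sigma> where M: "\<And>t. t \<in> I \<Longrightarrow> \<sigma> t > 0 \<and> (\<forall>s\<in>ball t (\<sigma> t). u (z, s) \<le> M t)"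
    by metis
  have cover: "I \<subseteq> (\<Union>t\<in>I. ball t (\<sigma> t))"
  proof
    fix t assume "t \<in> I"
    then show "t \<in> (\<Union>t\<in>I. ball t (\<sigma> t))"
      using M by (intro UN_I[of t]) auto
  qed
  obtain D where D: "D \<subseteq> I" "finite D" "I \<subseteq> (\<Union>t\<in>D. ball t (\<sigma> t))"
    by (rule compactE_image[OF I(1) _ cover]) auto
  show ?thesis
  proof
    fix t assume "t \<in> I"
    then obtain t' where "t' \<in> D" "t \<in> ball t' (\<sigma> t')"
      using D(3) by blast
    then have "u (z, t) \<le> M t'"
      using M D(1) by blast
    also have "\<dots> \<le> Max (M ` D)"
      using D(2) \<open>t' \<in> D\<close> by simp
    finally show "u (z, t) \<le> Max (M ` D)" .
  qed
qed

text \<open>A horizontal segment through a point over the new hull runs from the vertical line over the new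
  vertex to the strip over the old hull; its height changes by at most c.\<close>
lemma hconvex_fun_hull_bound:
  fixes R T t0 c :: real
  assumes \<Omega>: "open \<Omega>" and u: "hconvex_fun \<Omega> u" and cyl: "cball z0 R \<times> cball t0 T \<subseteq> \<Omega>"
    and c: "\<And>z a. \<lbrakk>z \<in> cball z0 R; a \<in> cball z0 R\<rbrakk> \<Longrightarrow> 2 * \<bar>im_herm z a\<bar> \<le> c"
    and F: "finite F" "F \<noteq> {}" "F \<subseteq> cball z0 R"
  shows "\<exists>M. \<forall>z\<in>convex hull F. \<forall>t\<in>cball t0 (T - card F * c). u (z, t) \<le> M"
  using F
proof (induction rule: finite_ne_induct)
  case (singleton a)
  then have a: "a \<in> cball z0 R"
    by simp
  then have "{a} \<times> cball t0 T \<subseteq> \<Omega>"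
    using cyl by auto
  then obtain M where M: "\<And>t. t \<in> cball t0 T \<Longrightarrow> u (a, t) \<le> M"
    using hconvex_fun_vertical_interval_bound[OF \<Omega> u compact_cball] by metis
  \<comment> \<open>The bound holds on all of \<open>cball t0 T\<close>; one c is given away so that
    the loss is uniformly \<open>card F * c\<close>.\<close>
  have "cball t0 (T - card {a} * c) \<subseteq> cball t0 T"
    using c[OF a a] by (intro subset_cball) simp
  then have "u (a, t) \<le> M" if "t \<in> cball t0 (T - card {a} * c)" for t
    using that by (intro M) (rule subsetD)
  then show ?case
    by (intro exI[of _ M]) simp
next
  case (insert a F)
  then have a: "a \<in> cball z0 R" and F: "F \<subseteq> cball z0 R"
    by auto
  then have hullF: "convex hull F \<subseteq> cball z0 R"
    by (intro hull_minimal) auto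
  have c0: "0 \<le> c"
    using c[OF a a] by simp
  obtain M1 where M1: "\<And>z t. \<lbrakk>z \<in> convex hull F; t \<in> cball t0 (T - card F * c)\<rbrakk> \<Longrightarrow> u (z, t) \<le> M1"
    using insert.IH[OF F] by blast
  have "{a} \<times> cball t0 T \<subseteq> \<Omega>"
    using a cyl by auto
  then obtain M2 where M2: "\<And>t. t \<in> cball t0 T \<Longrightarrow> u (a, t) \<le> M2"
    using hconvex_fun_vertical_interval_bound[OF \<Omega> u compact_cball] by metis
  have "u (z, t) \<le> max M1 M2"
    if z: "z \<in> convex hull (insert a F)" and t: "t \<in> cball t0 (T - card (insert a F) * c)" for z t
  proof -
    obtain b where b: "b \<in> convex hull F" "z \<in> closed_segment a b"
      using z \<open>F \<noteq> {}\<close> by (auto simp: convex_hull_insert_segments)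
    have bR: "b \<in> cball z0 R"
      using b hullF by blast
    have zR: "z \<in> cball z0 R"
      using b(2) a bR by (meson closed_segment_subset convex_cball subsetD)
    have t': "\<bar>t - t0\<bar> \<le> T - card F * c - c"
      using t insert.hyps by (simp add: dist_real_def algebra_simps abs_minus_commute)
    have Fc: "0 \<le> card F * c"
      using c0 by simp
    have ta: "t + 2 * im_herm z a \<in> cball t0 T"
      using c[OF zR a] t' Fc unfolding mem_cball dist_real_def by linarith
    have tb: "t + 2 * im_herm z b \<in> cball t0 (T - card F * c)"
      using c[OF zR bR] t' unfolding mem_cball dist_real_def by linarith
    then have tb': "t + 2 * im_herm z b \<in> cball t0 T"
      using Fc by simp
    show ?thesis
    proof (rule hconvex_fun_center_le[OF u])
      show "hlift (z, t) a \<in> \<Omega>" "hlift (z, t) b \<in> \<Omega>"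
        using ta tb' a bR cyl by (auto simp: hlift_def)
      show "fst (z, t) \<in> closed_segment a b"
        using b by simp
      show "u (hlift (z, t) a) \<le> max M1 M2"
        using M2[OF ta] by (simp add: hlift_def)
      show "u (hlift (z, t) b) \<le> max M1 M2"
        using M1[OF b(1) tb] by (simp add: hlift_def)
    qed
  qed
  then show ?case
    by blast
qed

text \<open>The hull bound is applied to the vertices of a small cube around z0. The number of
  vertices stays fixed while the loss c per vertex tends to 0 with the size \<rho>, so a small
  enough cube leaves an interval of heights of positive length.\<close>

lemma hconvex_fun_locally_bdd_above:
  fixes p :: "'n::finite heis"
  assumes \<Omega>: "open \<Omega>" and u: "hconvex_fun \<Omega> u" and p: "p \<in> \<Omega>"
  obtains M where "\<forall>\<^sub>F q in nhds p. u q \<le> M"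
proof -
  obtain z0 t0 where p_eq: "p = (z0, t0)"
    by (cases p)
  obtain A B where AB: "open A" "open B" "z0 \<in> A" "t0 \<in> B" "A \<times> B \<subseteq> \<Omega>"
    using \<Omega> p unfolding p_eq by (metis open_prod_elim mem_Times_iff fst_conv snd_conv)
  obtain R where R: "R > 0" "cball z0 R \<subseteq> A"
    using AB open_contains_cball by metis
  obtain T where T: "T > 0" "cball t0 T \<subseteq> B"
    using AB open_contains_cball by metis
  obtain F0 :: "((real^'n) \<times> (real^'n)) set" where F0: "finite F0"
      "cbox (0 - (\<Sum>i\<in>Basis. 1 *\<^sub>R i)) (0 + (\<Sum>i\<in>Basis. 1 *\<^sub>R i)) = convex hull F0"
    using cube_convex_hull[of 1] by (metis zero_less_one)
  have cube: "x \<in> convex hull F0" if "norm x \<le> 1" for x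
  proof -
    have "\<bar>x \<bullet> i\<bar> \<le> 1" if "i \<in> Basis" for i
      using Basis_le_norm[OF that, of x] \<open>norm x \<le> 1\<close> by linarith
    then have "x \<in> cbox (0 - (\<Sum>i\<in>Basis. 1 *\<^sub>R i)) (0 + (\<Sum>i\<in>Basis. 1 *\<^sub>R i))"
      by (auto simp: mem_box inner_diff_left inner_sum_left inner_Basis abs_le_iff sum.delta if_distrib cong: if_cong)
    then show ?thesis
      using F0(2) by simp
  qed
  have "F0 \<noteq> {}"
    using cube[of 0] by auto
  obtain B0 where B0: "B0 > 0" "\<And>x. x \<in> F0 \<Longrightarrow> norm x \<le> B0"
    using finite_imp_bounded[OF F0(1)] bounded_pos by metis
  obtain K where K: "K > 0" "\<And>z a :: (real^'n) \<times> (real^'n). \<bar>im_herm z a\<bar> \<le> norm z * norm a * K"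
    using im_herm.pos_bounded by (metis real_norm_def)
  \<comment> \<open>Since \<open>im_herm z a = im_herm z (a - z)\<close>, the form is controlled by
    the norm of a - z, at most 2 \<rho> B0, and not only by the norms of z and a. This factor makes
    c vanish at \<rho> = 0 even if z0 is large.\<close>
  define c where "c = (\<lambda>\<rho>. 2 * ((norm z0 + \<rho> * B0) * (2 * (\<rho> * B0)) * K))"
  have "((\<lambda>\<rho>. \<rho> * B0) \<longlongrightarrow> 0 * B0) (at_right 0)" "((\<lambda>\<rho>. card F0 * c \<rho>) \<longlongrightarrow> card F0 * c 0) (at_right 0)"
    unfolding c_def by (intro tendsto_intros)+
  then have "\<forall>\<^sub>F \<rho> in at_right 0. \<rho> * B0 < R" "\<forall>\<^sub>F \<rho> in at_right 0. card F0 * c \<rho> < T"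
    using R(1) T(1) by (auto simp: c_def dest: order_tendstoD)
  then have "\<forall>\<^sub>F \<rho> in at_right 0. 0 < \<rho> \<and> \<rho> * B0 < R \<and> card F0 * c \<rho> < T"
    using eventually_at_right_less by (intro eventually_conj) auto
  then obtain \<rho> where \<rho>: "0 < \<rho>" "\<rho> * B0 < R" "card F0 * c \<rho> < T"
    using eventually_happens[of _ "at_right (0::real)"] by (auto simp: trivial_limit_at_right_real)
  define F where "F = (\<lambda>x. z0 + \<rho> *\<^sub>R x) ` F0"
  have "\<exists>M. \<forall>z\<in>convex hull F. \<forall>t\<in>cball t0 (T - card F * c \<rho>). u (z, t) \<le> M"
  proof (rule hconvex_fun_hull_bound[OF \<Omega> u, where R = "\<rho> * B0"])
    have "cball z0 (\<rho> * B0) \<subseteq> cball z0 R"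
      using \<rho>(2) by (intro subset_cball) simp
    then show "cball z0 (\<rho> * B0) \<times> cball t0 T \<subseteq> \<Omega>"
      using R(2) T(2) AB(5) by (meson Sigma_mono order_trans)
    show "finite F" "F \<noteq> {}"
      using F0(1) \<open>F0 \<noteq> {}\<close> by (auto simp: F_def)
    show "F \<subseteq> cball z0 (\<rho> * B0)"
    proof
      fix y assume "y \<in> F"
      then obtain x where x: "x \<in> F0" "y = z0 + \<rho> *\<^sub>R x"
        unfolding F_def by (rule imageE)
      have "norm (\<rho> *\<^sub>R x) \<le> \<rho> * B0"
        using B0(2)[OF x(1)] \<rho>(1) by simp
      then show "y \<in> cball z0 (\<rho> * B0)"
        unfolding x(2) mem_cball dist_add_cancel[of z0 0, simplified] by (simp add: dist_norm del: norm_scaleR)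
    qed
    fix z a assume z: "z \<in> cball z0 (\<rho> * B0)" and a: "a \<in> cball z0 (\<rho> * B0)"
    have "norm z \<le> norm z0 + \<rho> * B0"
      using z norm_triangle_ineq2[of z z0] by (simp add: dist_norm norm_minus_commute)
    moreover have "norm (a - z) \<le> 2 * (\<rho> * B0)"
      using z a dist_triangle[of a z z0] by (simp add: dist_norm norm_minus_commute)
    ultimately have "norm z * norm (a - z) * K \<le> (norm z0 + \<rho> * B0) * (2 * (\<rho> * B0)) * K"
      using K(1) \<rho>(1) B0(1) by (intro mult_mono mult_nonneg_nonneg) auto
    moreover have "im_herm z a = im_herm z (a - z)"
      by (simp add: im_herm.diff_right)
    ultimately show "2 * \<bar>im_herm z a\<bar> \<le> c \<rho>"
      using K(2)[of z "a - z"] unfolding c_def by linarith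
  qed
  then obtain M where M: "\<And>z t. \<lbrakk>z \<in> convex hull F; t \<in> cball t0 (T - card F * c \<rho>)\<rbrakk> \<Longrightarrow> u (z, t) \<le> M"
    by blast
  have "c \<rho> \<ge> 0"
    using \<rho>(1) B0(1) K(1) by (auto simp: c_def intro!: mult_nonneg_nonneg)
  moreover have "card F \<le> card F0"
    unfolding F_def by (rule card_image_le[OF F0(1)])
  ultimately have "card F * c \<rho> \<le> card F0 * c \<rho>"
    by (intro mult_right_mono) auto
  then have pos: "T - card F * c \<rho> > 0"
    using \<rho>(3) by simp
  have "\<forall>\<^sub>F q in nhds p. q \<in> ball z0 \<rho> \<times> ball t0 (T - card F * c \<rho>)"
    using \<rho>(1) pos by (intro eventually_nhds_in_open open_Times) (auto simp: p_eq)
  then have "\<forall>\<^sub>F q in nhds p. u q \<le> M"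
  proof eventually_elim
    case (elim q)
    obtain z t where q: "q = (z, t)"
      by (cases q)
    have "norm ((1 / \<rho>) *\<^sub>R (z - z0)) \<le> 1"
      using elim \<rho>(1) by (simp add: q dist_norm norm_minus_commute)
    then have "z0 + \<rho> *\<^sub>R ((1 / \<rho>) *\<^sub>R (z - z0)) \<in> convex hull F"
      unfolding F_def convex_hull_affinity by (intro imageI cube)
    then have "z \<in> convex hull F"
      using \<rho>(1) by simp
    then show ?case
      unfolding q using elim by (intro M) (auto simp: q)
  qed
  then show ?thesis
    by (rule that)
qed

section \<open>Continuity of H-convex functions\<close>

text \<open>Prolong the segment from \<open>g x\<close> through \<open>h x\<close> by the factor
  1/\<epsilon>. For fixed \<epsilon> the far end still tends to p, so the bound M eventually holds
  there, and \<open>h x\<close> divides the prolonged segment in the ratio \<epsilon>.\<close>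

lemma eventually_hconvex_fun_ratio:
  assumes \<Omega>: "open \<Omega>" and u: "hconvex_fun \<Omega> u" and p: "p \<in> \<Omega>" and M: "\<forall>\<^sub>F q in nhds p. u q \<le> M"
    and g: "(g \<longlongrightarrow> p) F" and h: "(h \<longlongrightarrow> p) F" and gh: "\<And>x. h x \<in> hplane (g x)"
    and \<epsilon>: "0 < \<epsilon>" "\<epsilon> \<le> 1"
  shows "\<forall>\<^sub>F x in F. u (h x) \<le> (1 - \<epsilon>) * u (g x) + \<epsilon> * M"
proof -
  define k where "k = (\<lambda>x. fst (g x) + (1 / \<epsilon>) *\<^sub>R (fst (h x) - fst (g x)))"
  have "((\<lambda>x. hlift (g x) (k x)) \<longlongrightarrow> hlift p (fst p + (1 / \<epsilon>) *\<^sub>R (fst p - fst p))) F"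
    unfolding k_def by (intro tendsto_intros g h)
  then have k: "((\<lambda>x. hlift (g x) (k x)) \<longlongrightarrow> p) F"
    by simp
  have "\<forall>\<^sub>F q in nhds p. q \<in> \<Omega>"
    using \<Omega> p by (rule eventually_nhds_in_open)
  then have "\<forall>\<^sub>F x in F. g x \<in> \<Omega>" "\<forall>\<^sub>F x in F. hlift (g x) (k x) \<in> \<Omega>"
    using g k by (auto simp: filterlim_iff)
  moreover have "\<forall>\<^sub>F x in F. u (hlift (g x) (k x)) \<le> M"
    using k M by (auto simp: filterlim_iff)
  ultimately show ?thesis
  proof eventually_elim
    case (elim x)
    have "(1 - \<epsilon>) *\<^sub>R fst (g x) + \<epsilon> *\<^sub>R k x = fst (h x)"
      using \<epsilon>(1) by (simp add: k_def algebra_simps)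
    then have hx: "hlift (g x) ((1 - \<epsilon>) *\<^sub>R fst (g x) + \<epsilon> *\<^sub>R k x) = h x"
      using gh[of x] by (simp add: hplane_iff)
    have "u (h x) \<le> (1 - \<epsilon>) * u (g x) + \<epsilon> * u (hlift (g x) (k x))"
      using hconvex_fun_ray[OF u elim(1,2) less_imp_le[OF \<epsilon>(1)] \<epsilon>(2)] unfolding hx .
    also have "\<dots> \<le> (1 - \<epsilon>) * u (g x) + \<epsilon> * M"
      using elim(3) \<epsilon> by simp
    finally show ?case .
  qed
qed

text \<open>Convergence of the values passes from g to h across a horizontal step. The ratio
  estimate from g to h bounds \<open>u (h x)\<close> from above; with g and h exchanged it bounds it
  from below.\<close>

lemma hconvex_fun_tendsto_step:
  assumes \<Omega>: "open \<Omega>" and u: "hconvex_fun \<Omega> u" and p: "p \<in> \<Omega>"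
    and g: "(g \<longlongrightarrow> p) F" and h: "(h \<longlongrightarrow> p) F" and gh: "\<And>x. h x \<in> hplane (g x)"
    and ug: "((\<lambda>x. u (g x)) \<longlongrightarrow> u p) F"
  shows "((\<lambda>x. u (h x)) \<longlongrightarrow> u p) F"
proof -
  obtain M where M: "\<forall>\<^sub>F q in nhds p. u q \<le> M"
    by (rule hconvex_fun_locally_bdd_above[OF \<Omega> u p])
  have small: "\<forall>\<^sub>F \<epsilon> in at_right (0::real). 0 < \<epsilon> \<and> \<epsilon> < 1"
    by (auto simp: eventually_at_right_field intro!: exI[of _ 1])
  show ?thesis
  proof (rule order_tendstoI)
    fix a assume a: "u p < a"
    have "((\<lambda>\<epsilon>. (1 - \<epsilon>) * u p + \<epsilon> * M) \<longlongrightarrow> (1 - 0) * u p + 0 * M) (at_right 0)"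
      by (intro tendsto_intros)
    then have "\<forall>\<^sub>F \<epsilon> in at_right 0. (1 - \<epsilon>) * u p + \<epsilon> * M < a"
      using a by (auto dest: order_tendstoD)
    with small have "\<forall>\<^sub>F \<epsilon> in at_right 0. 0 < \<epsilon> \<and> \<epsilon> < 1 \<and> (1 - \<epsilon>) * u p + \<epsilon> * M < a"
      by eventually_elim auto
    then obtain \<epsilon> where \<epsilon>: "0 < \<epsilon>" "\<epsilon> < 1" "(1 - \<epsilon>) * u p + \<epsilon> * M < a"
      using eventually_happens[of _ "at_right (0::real)"] by (auto simp: trivial_limit_at_right_real)
    have "((\<lambda>x. (1 - \<epsilon>) * u (g x) + \<epsilon> * M) \<longlongrightarrow> (1 - \<epsilon>) * u p + \<epsilon> * M) F"
      by (intro tendsto_intros ug)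
    then have "\<forall>\<^sub>F x in F. (1 - \<epsilon>) * u (g x) + \<epsilon> * M < a"
      using \<epsilon>(3) by (auto dest: order_tendstoD)
    then show "\<forall>\<^sub>F x in F. u (h x) < a"
      using eventually_hconvex_fun_ratio[OF \<Omega> u p M g h gh \<epsilon>(1) less_imp_le[OF \<epsilon>(2)]]
      by eventually_elim simp
  next
    fix a assume a: "a < u p"
    \<comment> \<open>With the roles exchanged, \<open>u (h x) \<le> a\<close> would keep
      \<open>u (g x)\<close> at or below this value, which for small \<epsilon> is less than the
      limit \<open>u p\<close>.\<close>
    have "((\<lambda>\<epsilon>. (1 - \<epsilon>) * a + \<epsilon> * M) \<longlongrightarrow> (1 - 0) * a + 0 * M) (at_right 0)"
      by (intro tendsto_intros)
    then have "\<forall>\<^sub>F \<epsilon> in at_right 0. (1 - \<epsilon>) * a + \<epsilon> * M < u p"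
      using a by (auto dest: order_tendstoD)
    with small have "\<forall>\<^sub>F \<epsilon> in at_right 0. 0 < \<epsilon> \<and> \<epsilon> < 1 \<and> (1 - \<epsilon>) * a + \<epsilon> * M < u p"
      by eventually_elim auto
    then obtain \<epsilon> where \<epsilon>: "0 < \<epsilon>" "\<epsilon> < 1" "(1 - \<epsilon>) * a + \<epsilon> * M < u p"
      using eventually_happens[of _ "at_right (0::real)"] by (auto simp: trivial_limit_at_right_real)
    have "\<forall>\<^sub>F x in F. (1 - \<epsilon>) * a + \<epsilon> * M < u (g x)"
      using \<epsilon>(3) ug by (auto dest: order_tendstoD)
    then show "\<forall>\<^sub>F x in F. a < u (h x)"
      using eventually_hconvex_fun_ratio[OF \<Omega> u p M h g hplane_sym[OF gh] \<epsilon>(1) less_imp_le[OF \<epsilon>(2)]]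
    proof eventually_elim
      case (elim x)
      then have "(1 - \<epsilon>) * a < (1 - \<epsilon>) * u (h x)"
        by linarith
      then show ?case
        using \<epsilon>(2) by simp
    qed
  qed
qed

text \<open>Any point near p is reached from p by five short horizontal steps, the last four of them
  closing up over a parallelogram spanned by multiples of e and f.\<close>
lemma hconvex_fun_continuous_on:
  fixes u :: "'n::finite heis \<Rightarrow> real"
  assumes \<Omega>: "open \<Omega>" and u: "hconvex_fun \<Omega> u"
  shows "continuous_on \<Omega> u"
proof -
  have "(u \<longlongrightarrow> u p) (at p)" if p: "p \<in> \<Omega>" for p
  proof -
    obtain e f :: "(real^'n) \<times> (real^'n)" where ef: "im_herm e f = 1"
      by (rule im_herm_nondegenerate)
    then have fe: "im_herm f e = -1"
      using im_herm_swap[of f e] by simp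
    define s where "s = (\<lambda>m :: 'n heis. snd m - snd (hlift p (fst m)))"
    \<comment> \<open>\<open>s m\<close> is the height of m above \<open>hplane p\<close>. Going
      round the parallelogram with sides a e and b f changes the height by 4 a b; hence the factor
      1/4, and the sign placed in b. The square roots make both sides tend to 0 with s.\<close>
    define a where "a = (\<lambda>m. sqrt \<bar>s m\<bar>)"
    define b where "b = (\<lambda>m. sgn (s m) * sqrt \<bar>s m\<bar> / 4)"
    define g1 where "g1 = (\<lambda>m :: 'n heis. hlift p (fst m))"
    define g2 where "g2 = (\<lambda>m. hlift (g1 m) (fst m + a m *\<^sub>R e))"
    define g3 where "g3 = (\<lambda>m. hlift (g2 m) (fst m + a m *\<^sub>R e + b m *\<^sub>R f))"
    define g4 where "g4 = (\<lambda>m. hlift (g3 m) (fst m + b m *\<^sub>R f))"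
    define g5 where "g5 = (\<lambda>m. hlift (g4 m) (fst m))"
    have "(s \<longlongrightarrow> snd p - snd (hlift p (fst p))) (at p)"
      unfolding s_def by (intro tendsto_intros)
    then have "(s \<longlongrightarrow> 0) (at p)"
      by simp
    then have "(a \<longlongrightarrow> sqrt \<bar>0\<bar>) (at p)"
      unfolding a_def by (intro tendsto_intros)
    then have a: "(a \<longlongrightarrow> 0) (at p)"
      by simp
    have b: "(b \<longlongrightarrow> 0) (at p)"
    proof (rule Lim_null_comparison[OF _ a])
      show "\<forall>\<^sub>F m in at p. norm (b m) \<le> a m"
        by (simp add: a_def b_def abs_mult sgn_real_def)
    qed
    have lim: "(g1 \<longlongrightarrow> p) (at p)" "(g2 \<longlongrightarrow> p) (at p)" "(g3 \<longlongrightarrow> p) (at p)" "(g4 \<longlongrightarrow> p) (at p)" "(g5 \<longlongrightarrow> p) (at p)"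
    proof -
      have "(g1 \<longlongrightarrow> hlift p (fst p)) (at p)"
        unfolding g1_def by (intro tendsto_intros)
      then show 1: "(g1 \<longlongrightarrow> p) (at p)"
        by simp
      have "(g2 \<longlongrightarrow> hlift p (fst p + 0 *\<^sub>R e)) (at p)"
        unfolding g2_def by (intro tendsto_intros a 1)
      then show 2: "(g2 \<longlongrightarrow> p) (at p)"
        by simp
      have "(g3 \<longlongrightarrow> hlift p (fst p + 0 *\<^sub>R e + 0 *\<^sub>R f)) (at p)"
        unfolding g3_def by (intro tendsto_intros a b 2)
      then show 3: "(g3 \<longlongrightarrow> p) (at p)"
        by simp
      have "(g4 \<longlongrightarrow> hlift p (fst p + 0 *\<^sub>R f)) (at p)"
        unfolding g4_def by (intro tendsto_intros b 3)
      then show 4: "(g4 \<longlongrightarrow> p) (at p)"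
        by simp
      have "(g5 \<longlongrightarrow> hlift p (fst p)) (at p)"
        unfolding g5_def by (intro tendsto_intros 4)
      then show "(g5 \<longlongrightarrow> p) (at p)"
        by simp
    qed
    note step = hconvex_fun_tendsto_step[OF \<Omega> u p]
    have u1: "((\<lambda>m. u (g1 m)) \<longlongrightarrow> u p) (at p)"
      by (rule step[OF tendsto_const lim(1)]) (simp_all add: g1_def)
    have u2: "((\<lambda>m. u (g2 m)) \<longlongrightarrow> u p) (at p)"
      by (rule step[OF lim(1) lim(2) _ u1]) (simp add: g2_def)
    have u3: "((\<lambda>m. u (g3 m)) \<longlongrightarrow> u p) (at p)"
      by (rule step[OF lim(2) lim(3) _ u2]) (simp add: g3_def)
    have u4: "((\<lambda>m. u (g4 m)) \<longlongrightarrow> u p) (at p)"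
      by (rule step[OF lim(3) lim(4) _ u3]) (simp add: g4_def)
    have u5: "((\<lambda>m. u (g5 m)) \<longlongrightarrow> u p) (at p)"
      by (rule step[OF lim(4) lim(5) _ u4]) (simp add: g5_def)
    have "g5 m = m" for m
    proof -
      have "4 * (a m * b m) = sgn (s m) * (sqrt \<bar>s m\<bar> * sqrt \<bar>s m\<bar>)"
        by (simp add: a_def b_def)
      also have "\<dots> = s m"
        by (simp add: sgn_mult_abs)
      finally have ab: "4 * (a m * b m) = s m" .
      define x where "x = a m * im_herm (fst m) e"
      define y where "y = b m * im_herm (fst m) f"
      define c where "c = a m * b m"
      have "snd (g2 m) = snd (g1 m) + 2 * x"
        by (simp add: g2_def g1_def hlift_def im_herm_simps x_def)
      moreover have "im_herm (fst m + a m *\<^sub>R e) (fst m + a m *\<^sub>R e + b m *\<^sub>R f) = y + c"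
        by (simp add: im_herm_simps ef im_herm_swap[of e "fst m"] y_def c_def algebra_simps)
      then have "snd (g3 m) = snd (g2 m) + 2 * (y + c)"
        by (simp add: g3_def g2_def hlift_def)
      moreover have "im_herm (fst m + a m *\<^sub>R e + b m *\<^sub>R f) (fst m + b m *\<^sub>R f) = c - x"
        by (simp add: im_herm_simps ef fe im_herm_swap[of e "fst m"] im_herm_swap[of f "fst m"]
            x_def c_def algebra_simps)
      then have "snd (g4 m) = snd (g3 m) + 2 * (c - x)"
        by (simp add: g4_def g3_def hlift_def)
      moreover have "snd (g5 m) = snd (g4 m) - 2 * y"
        by (simp add: g5_def g4_def hlift_def im_herm_simps im_herm_swap[of f "fst m"] y_def)
      ultimately have "snd (g5 m) = snd (g1 m) + s m"
        using ab[folded c_def] by simp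
      then have "snd (g5 m) = snd m"
        by (simp add: g1_def s_def)
      moreover have "fst (g5 m) = fst m"
        by (simp add: g5_def)
      ultimately show ?thesis
        by (simp add: prod_eqI)
    qed
    then show ?thesis
      using u5 by simp
  qed
  then show ?thesis
    by (intro continuous_at_imp_continuous_on ballI) (simp add: isCont_def)
qed

section \<open>Jensen's inequality on a horizontal plane\<close>

text \<open>Converse of \<open>hconvex_fun_center\<close>. H-convexity of the sup-convolution is
  verified in this form.\<close>

lemma hconvex_funI:
  assumes "\<And>m a b r. \<lbrakk>hlift m a \<in> S; hlift m b \<in> S; 0 \<le> r; r \<le> 1; fst m = (1 - r) *\<^sub>R a + r *\<^sub>R b\<rbrakk>
    \<Longrightarrow> u m \<le> (1 - r) * u (hlift m a) + r * u (hlift m b)"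
  shows "hconvex_fun S u"
  unfolding hconvex_fun_def
proof (intro ballI impI)
  fix p1 p2 and r :: real
  assume p: "p1 \<in> S" "p2 \<in> S" "p1 \<in> hplane p2" and r: "r \<in> {0..1}"
  define m where "m = p1 \<circ>\<^sub>H hdil r (hinv p1 \<circ>\<^sub>H p2)"
  have p2: "p2 = hlift p1 (fst p2)"
    using hplane_sym[OF p(3)] by (simp add: hplane_iff)
  have "snd p2 = snd p1 + 2 * im_herm (fst p1) (fst p2)"
    by (subst p2) (simp add: hlift_def)
  then have m: "m = hlift p1 ((1 - r) *\<^sub>R fst p1 + r *\<^sub>R fst p2)"
    unfolding m_def hmult_def hdil_def hinv_def hlift_def
    by (auto simp: im_herm_simps algebra_simps)
  have "hlift m (fst p2) = p2" "hlift m (fst p1) = p1"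
    unfolding m using hlift_hlift[where r = r and p = p1 and a = "fst p2", OF refl] p2[symmetric] by simp_all
  moreover have "fst m = (1 - r) *\<^sub>R fst p1 + r *\<^sub>R fst p2"
    by (simp add: m)
  ultimately show "u (p1 \<circ>\<^sub>H hdil r (hinv p1 \<circ>\<^sub>H p2)) \<le> (1 - r) * u p1 + r * u p2"
    using assms[of m "fst p1" "fst p2" r] p r by (simp flip: m_def)
qed

text \<open>Two points of a horizontal plane are not horizontally related to each other, but at scale \<tau> the
  defect is a vertical displacement of order \<tau>^2. Hence the first order upper bounds for u along
  rays from p form a convex set.\<close>
lemma hconvex_fun_jensen_lipschitz:
  fixes p :: "'n::finite heis" and w :: "'i \<Rightarrow> (real^'n) \<times> (real^'n)"
  assumes S: "open S" and u: "hconvex_fun S u" and p: "p \<in> S"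
    and L: "\<And>z t t'. \<lbrakk>(z, t) \<in> S; (z, t') \<in> S\<rbrakk> \<Longrightarrow> u (z, t) \<le> u (z, t') + L * \<bar>t - t'\<bar>"
    and I: "finite I" "\<And>i. i \<in> I \<Longrightarrow> 0 \<le> c i" "sum c I = 1"
    and w: "(\<Sum>i\<in>I. c i *\<^sub>R w i) = fst p" "\<And>i. i \<in> I \<Longrightarrow> hlift p (w i) \<in> S"
  shows "u p \<le> (\<Sum>i\<in>I. c i * u (hlift p (w i)))"
proof -
  define P where "P = (\<lambda>\<tau> y. hlift p (fst p + \<tau> *\<^sub>R y))"
  \<comment> \<open>A plays the part of the epigraph of the directional derivative of u at p, with a
    quadratic error allowed. Once A is convex, it contains the average of the pairs given by the
    points \<open>w i\<close>, whose direction is 0.\<close>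
  define A where "A = {(y, d). \<exists>C. \<forall>\<^sub>F \<tau> in at_right 0. u (P \<tau> y) \<le> u p + \<tau> * d + C * \<tau>\<^sup>2}"
  have evS: "\<forall>\<^sub>F \<tau> in F. f \<tau> \<in> S" if "(f \<longlongrightarrow> p) F" for f and F :: "real filter"
    using that S p by (rule topological_tendstoD)
  have Plim: "((\<lambda>\<tau>. P \<tau> y) \<longlongrightarrow> p) (at_right 0)" for y
  proof -
    have "((\<lambda>\<tau>. P \<tau> y) \<longlongrightarrow> hlift p (fst p + 0 *\<^sub>R y)) (at_right 0)"
      unfolding P_def by (intro tendsto_intros)
    then show ?thesis
      by simp
  qed
  have two: "(1 - r) *\<^sub>R (y1, d1) + r *\<^sub>R (y2, d2) \<in> A"
    if 1: "(y1, d1) \<in> A" and 2: "(y2, d2) \<in> A" and r: "0 \<le> r" "r \<le> 1" for y1 d1 y2 d2 and r :: real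
  proof -
    obtain C1 where C1: "\<forall>\<^sub>F \<tau> in at_right 0. u (P \<tau> y1) \<le> u p + \<tau> * d1 + C1 * \<tau>\<^sup>2"
      using 1 by (auto simp: A_def)
    obtain C2 where C2: "\<forall>\<^sub>F \<tau> in at_right 0. u (P \<tau> y2) \<le> u p + \<tau> * d2 + C2 * \<tau>\<^sup>2"
      using 2 by (auto simp: A_def)
    define y where "y = (1 - r) *\<^sub>R y1 + r *\<^sub>R y2"
    \<comment> \<open>\<open>Q \<tau> x\<close> and \<open>P \<tau> x\<close> have the same
      projection. The first lies in the plane of \<open>P \<tau> y\<close>, where H-convexity with
      centre \<open>P \<tau> y\<close> applies; the second lies in the plane of p, where the bounds
      from A hold. The Lipschitz condition pays for the height 2 \<tau>^2 \<open>im_herm y x\<close>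
      between them.\<close>
    define Q where "Q = (\<lambda>\<tau> x. hlift (P \<tau> y) (fst p + \<tau> *\<^sub>R x))"
    define E where "E = (\<lambda>x. 2 * L * \<bar>im_herm y x\<bar>)"
    have Qlim: "((\<lambda>\<tau>. Q \<tau> x) \<longlongrightarrow> p) (at_right 0)" for x
    proof -
      have "((\<lambda>\<tau>. Q \<tau> x) \<longlongrightarrow> hlift p (fst p + 0 *\<^sub>R x)) (at_right 0)"
        unfolding Q_def by (intro tendsto_intros Plim)
      then show ?thesis
        by simp
    qed
    have Q: "Q \<tau> x = (fst p + \<tau> *\<^sub>R x, snd (P \<tau> x) + 2 * \<tau>\<^sup>2 * im_herm y x)" for \<tau> x
      unfolding Q_def P_def
      by (simp add: hlift_def im_herm_simps im_herm_swap[of y "fst p"] power2_eq_square algebra_simps)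
    have P_eq: "P \<tau> x = (fst p + \<tau> *\<^sub>R x, snd (P \<tau> x))" for \<tau> x
      by (simp add: P_def hlift_def)
    have QP: "u (Q \<tau> x) \<le> u (P \<tau> x) + E x * \<tau>\<^sup>2" if "Q \<tau> x \<in> S" "P \<tau> x \<in> S" for \<tau> x
    proof -
      have "u (Q \<tau> x) \<le> u (P \<tau> x) + L * \<bar>2 * \<tau>\<^sup>2 * im_herm y x\<bar>"
        using L[of "fst p + \<tau> *\<^sub>R x" "snd (P \<tau> x) + 2 * \<tau>\<^sup>2 * im_herm y x" "snd (P \<tau> x)"]
        unfolding Q[symmetric] P_eq[symmetric] using that by simp
      then show ?thesis
        by (simp add: E_def abs_mult algebra_simps)
    qed
    define C where "C = (1 - r) * (C1 + E y1) + r * (C2 + E y2)"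
    have "\<forall>\<^sub>F \<tau> in at_right 0. u (P \<tau> y) \<le> u p + \<tau> * ((1 - r) * d1 + r * d2) + C * \<tau>\<^sup>2"
      using C1 C2 evS[OF Plim[of y1]] evS[OF Plim[of y2]] evS[OF Qlim[of y1]] evS[OF Qlim[of y2]]
    proof eventually_elim
      case (elim \<tau>)
      have "u (P \<tau> y) \<le> (1 - r) * u (Q \<tau> y1) + r * u (Q \<tau> y2)"
        unfolding Q_def
      proof (rule hconvex_fun_center[OF u])
        show "fst (P \<tau> y) = (1 - r) *\<^sub>R (fst p + \<tau> *\<^sub>R y1) + r *\<^sub>R (fst p + \<tau> *\<^sub>R y2)"
          by (simp add: P_def y_def algebra_simps)
      qed (use elim r in \<open>auto simp: Q_def\<close>)
      also have "\<dots> \<le> (1 - r) * (u p + \<tau> * d1 + C1 * \<tau>\<^sup>2 + E y1 * \<tau>\<^sup>2)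
          + r * (u p + \<tau> * d2 + C2 * \<tau>\<^sup>2 + E y2 * \<tau>\<^sup>2)"
        using QP[of \<tau> y1] QP[of \<tau> y2] elim r by (intro add_mono mult_left_mono) auto
      also have "\<dots> = u p + \<tau> * ((1 - r) * d1 + r * d2) + C * \<tau>\<^sup>2"
        by (simp add: C_def algebra_simps)
      finally show ?case .
    qed
    then show ?thesis
      by (auto simp: A_def y_def)
  qed
  have "convex A"
    unfolding convex_alt using two by auto
  moreover have "(w i - fst p, u (hlift p (w i)) - u p) \<in> A" if "i \<in> I" for i
  proof -
    have "\<forall>\<^sub>F \<tau> in at_right (0::real). 0 < \<tau> \<and> \<tau> < 1"
      by (auto simp: eventually_at_right_field intro!: exI[of _ 1])
    then have "\<forall>\<^sub>F \<tau> in at_right 0. u (P \<tau> (w i - fst p)) \<le> u p + \<tau> * (u (hlift p (w i)) - u p) + 0 * \<tau>\<^sup>2"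
    proof eventually_elim
      case (elim \<tau>)
      have "fst p + \<tau> *\<^sub>R (w i - fst p) = (1 - \<tau>) *\<^sub>R fst p + \<tau> *\<^sub>R w i"
        by (simp add: algebra_simps)
      then show ?case
        using hconvex_fun_ray[OF u p w(2)[OF that], of \<tau>] elim by (simp add: P_def algebra_simps)
    qed
    then show ?thesis
      unfolding A_def by blast
  qed
  ultimately have "(\<Sum>i\<in>I. c i *\<^sub>R (w i - fst p, u (hlift p (w i)) - u p)) \<in> A"
    using I by (intro convex_sum) auto
  moreover have "(\<Sum>i\<in>I. c i *\<^sub>R (w i - fst p, u (hlift p (w i)) - u p))
      = (0, (\<Sum>i\<in>I. c i * u (hlift p (w i))) - u p)"
    using w(1) I(3) by (simp add: prod_eq_iff fst_sum snd_sum scaleR_diff_right right_diff_distrib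
        sum_subtractf flip: scaleR_left.sum sum_distrib_right)
  ultimately obtain C where
    C: "\<forall>\<^sub>F \<tau> in at_right 0. u p \<le> u p + \<tau> * ((\<Sum>i\<in>I. c i * u (hlift p (w i))) - u p) + C * \<tau>\<^sup>2"
    by (auto simp: A_def P_def)
  \<comment> \<open>As \<open>P \<tau> 0 = p\<close>, membership of (0, d) in A reads 0 \<le> \<tau>
    d + C \<tau>^2. Dividing by \<tau> and letting \<tau> tend to 0 removes the error.\<close>
  define d where "d = (\<Sum>i\<in>I. c i * u (hlift p (w i))) - u p"
  have "0 \<le> d + C * 0"
  proof (rule tendsto_lowerbound)
    show "((\<lambda>\<tau>. d + C * \<tau>) \<longlongrightarrow> d + C * 0) (at_right 0)"
      by (intro tendsto_intros)
    show "\<forall>\<^sub>F \<tau> in at_right 0. 0 \<le> d + C * \<tau>"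
      using C eventually_at_right_less[of "0::real"]
    proof eventually_elim
      case (elim \<tau>)
      then have "0 \<le> \<tau> * (d + C * \<tau>)"
        by (simp add: d_def power2_eq_square algebra_simps)
      then show ?case
        using elim(2) by (simp add: zero_le_mult_iff)
    qed
  qed simp
  then show ?thesis
    by (simp add: d_def)
qed

text \<open>Vertical translations are central, so the sup-convolution of u in the vertical variable is
  again H-convex, and it is vertically Lipschitz.\<close>
lemma hconvex_fun_jensen_local:
  fixes u :: "'n::finite heis \<Rightarrow> real" and w :: "'i \<Rightarrow> (real^'n) \<times> (real^'n)"
  assumes \<Omega>: "open \<Omega>" and u: "hconvex_fun \<Omega> u"
    and sub: "ball z0 \<rho> \<times> cball t0 (2 * \<sigma>) \<subseteq> \<Omega>" and \<sigma>: "\<rho> > 0" "\<sigma> > 0"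
    and M: "\<And>q. q \<in> ball z0 \<rho> \<times> cball t0 (2 * \<sigma>) \<Longrightarrow> \<bar>u q\<bar> \<le> M"
    and I: "finite I" "\<And>i. i \<in> I \<Longrightarrow> 0 \<le> c i" "sum c I = 1"
    and w: "(\<Sum>i\<in>I. c i *\<^sub>R w i) = z0" "\<And>i. i \<in> I \<Longrightarrow> hlift (z0, t0) (w i) \<in> ball z0 \<rho> \<times> ball t0 \<sigma>"
  shows "u (z0, t0) \<le> (\<Sum>i\<in>I. c i * u (hlift (z0, t0) (w i)))"
proof -
  \<comment> \<open>Competing heights range over J, of radius 2 \<sigma>, while H-convexity is shown
    on S, of radius \<sigma>. A shift by at most \<sigma> from S stays in J; for a larger shift the
    penalty exceeds 2 M once 2 M \<le> k \<sigma>, and such a competitor is worth at most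
    -M.\<close>
  define J where "J = cball t0 (2 * \<sigma>)"
  define S where "S = ball z0 \<rho> \<times> ball t0 \<sigma>"
  define U where "U = (\<lambda>k q. SUP t'\<in>J. u (fst q, t') - k * \<bar>snd q - t'\<bar>)"
  have J: "J \<noteq> {}" "\<And>t. t \<in> ball t0 \<sigma> \<Longrightarrow> t \<in> J"
    using \<sigma>(2) by (auto simp: J_def)
  have SJ: "S \<subseteq> ball z0 \<rho> \<times> J"
    using J(2) by (auto simp: S_def)
  have M0: "0 \<le> M"
    using M[of "(z0, t0)"] \<sigma> by auto
  have uM: "\<bar>u (z, t)\<bar> \<le> M" if "z \<in> ball z0 \<rho>" "t \<in> J" for z t
    using M[of "(z, t)"] that by (simp add: J_def)
  have bdd: "bdd_above ((\<lambda>t'. u (z, t') - k * \<bar>t - t'\<bar>) ` J)" if "z \<in> ball z0 \<rho>" "0 \<le> k" for k z t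
  proof (rule bdd_aboveI2)
    fix t' assume "t' \<in> J"
    then have "u (z, t') \<le> M"
      using uM[OF that(1)] by (simp add: abs_le_iff)
    moreover have "0 \<le> k * \<bar>t - t'\<bar>"
      using that by simp
    ultimately show "u (z, t') - k * \<bar>t - t'\<bar> \<le> M"
      by linarith
  qed
  have U_upper: "u (z, t') - k * \<bar>t - t'\<bar> \<le> U k (z, t)" if "z \<in> ball z0 \<rho>" "0 \<le> k" "t' \<in> J" for k z t t'
    unfolding U_def using cSUP_upper[OF that(3) bdd[OF that(1,2), of t]] by simp
  have U_least: "U k (z, t) \<le> B" if "\<And>t'. t' \<in> J \<Longrightarrow> u (z, t') - k * \<bar>t - t'\<bar> \<le> B" for k z t B
    unfolding U_def using that J(1) by (intro cSUP_least) auto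
  have U_ge: "u (z, t) \<le> U k (z, t)" if "z \<in> ball z0 \<rho>" "0 \<le> k" "t \<in> J" for k z t
    using U_upper[OF that, of t] by simp
  have U_lip: "U k (z, t) \<le> U k (z, t') + k * \<bar>t - t'\<bar>" if "z \<in> ball z0 \<rho>" "0 \<le> k" for k z t t'
  proof (rule U_least)
    fix s assume s: "s \<in> J"
    have "k * \<bar>t' - s\<bar> \<le> k * (\<bar>t - s\<bar> + \<bar>t - t'\<bar>)"
      using that(2) by (intro mult_left_mono) auto
    then show "u (z, s) - k * \<bar>t - s\<bar> \<le> U k (z, t') + k * \<bar>t - t'\<bar>"
      using U_upper[OF that s, of t'] by (simp add: distrib_left)
  qed
  have U_hconvex: "hconvex_fun S (U k)" if k: "0 \<le> k" "2 * M \<le> k * \<sigma>" for k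
  proof (rule hconvex_funI)
    fix m a b and r :: real
    assume a: "hlift m a \<in> S" and b: "hlift m b \<in> S" and r: "0 \<le> r" "r \<le> 1"
      and m: "fst m = (1 - r) *\<^sub>R a + r *\<^sub>R b"
    define \<alpha> where "\<alpha> = 2 * im_herm (fst m) a"
    define \<beta> where "\<beta> = 2 * im_herm (fst m) b"
    have la: "hlift (fst m, s) a = (a, s + \<alpha>)" and lb: "hlift (fst m, s) b = (b, s + \<beta>)" for s
      by (simp_all add: hlift_def \<alpha>_def \<beta>_def)
    have ma: "hlift m a = (a, snd m + \<alpha>)" and mb: "hlift m b = (b, snd m + \<beta>)"
      by (simp_all add: hlift_def \<alpha>_def \<beta>_def)
    have aS: "a \<in> ball z0 \<rho>" "snd m + \<alpha> \<in> ball t0 \<sigma>" and bS: "b \<in> ball z0 \<rho>" "snd m + \<beta> \<in> ball t0 \<sigma>"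
      using a b by (auto simp: S_def ma mb)
    have mS: "fst m \<in> ball z0 \<rho>"
      unfolding m using convex_ball aS(1) bS(1) r by (rule convexD_alt)
    have Ua: "- M \<le> U k (a, snd m + \<alpha>)" and Ub: "- M \<le> U k (b, snd m + \<beta>)"
      using U_ge[OF aS(1) k(1) J(2)[OF aS(2)]] uM[OF aS(1) J(2)[OF aS(2)]]
        U_ge[OF bS(1) k(1) J(2)[OF bS(2)]] uM[OF bS(1) J(2)[OF bS(2)]] by (simp_all add: abs_le_iff)
    have "U k (fst m, snd m) \<le> (1 - r) * U k (a, snd m + \<alpha>) + r * U k (b, snd m + \<beta>)"
    proof (rule U_least)
      fix t' assume t': "t' \<in> J"
      define s where "s = t' - snd m"
      show "u (fst m, t') - k * \<bar>snd m - t'\<bar> \<le> (1 - r) * U k (a, snd m + \<alpha>) + r * U k (b, snd m + \<beta>)"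
      proof (cases "\<bar>s\<bar> \<le> \<sigma>")
        case True
        have aJ: "t' + \<alpha> \<in> J" and bJ: "t' + \<beta> \<in> J"
          using True aS(2) bS(2) unfolding J_def mem_cball mem_ball dist_real_def s_def by linarith+
        have "hlift (fst m, t') a \<in> \<Omega>" "hlift (fst m, t') b \<in> \<Omega>"
          using aJ bJ aS(1) bS(1) unfolding la lb J_def by (auto intro!: subsetD[OF sub])
        then have "u (fst m, t') \<le> (1 - r) * u (hlift (fst m, t') a) + r * u (hlift (fst m, t') b)"
          by (rule hconvex_fun_center[OF u]) (use r m in simp_all)
        also have "\<dots> \<le> (1 - r) * (U k (a, snd m + \<alpha>) + k * \<bar>s\<bar>) + r * (U k (b, snd m + \<beta>) + k * \<bar>s\<bar>)"
          unfolding la lb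
          using U_upper[OF aS(1) k(1) aJ, of "snd m + \<alpha>"] U_upper[OF bS(1) k(1) bJ, of "snd m + \<beta>"] r
          by (intro add_mono mult_left_mono) (auto simp: s_def abs_minus_commute)
        also have "\<dots> = (1 - r) * U k (a, snd m + \<alpha>) + r * U k (b, snd m + \<beta>) + k * \<bar>s\<bar>"
          by (simp add: algebra_simps)
        finally show ?thesis
          by (simp add: s_def abs_minus_commute)
      next
        case False
        have "k * \<sigma> \<le> k * \<bar>s\<bar>"
          using False k(1) by (intro mult_left_mono) auto
        then have "u (fst m, t') - k * \<bar>snd m - t'\<bar> \<le> - M"
          using uM[OF mS t'] k(2) by (simp add: s_def abs_minus_commute abs_le_iff)
        also have "- M = (1 - r) * (- M) + r * (- M)"
          by (simp add: algebra_simps)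
        also have "\<dots> \<le> (1 - r) * U k (a, snd m + \<alpha>) + r * U k (b, snd m + \<beta>)"
          using Ua Ub r by (intro add_mono mult_left_mono) auto
        finally show ?thesis .
      qed
    qed
    then show "U k m \<le> (1 - r) * U k (hlift m a) + r * U k (hlift m b)"
      by (simp add: ma mb)
  qed
  \<comment> \<open>Heights within \<delta> are handled by the continuity of u, all others by the
    penalty, which is at least 2 M there.\<close>
  have U_approx: "\<forall>\<^sub>F k in at_top. U k q \<le> u q + e" if q: "q \<in> S" and e: "e > 0" for q e
  proof -
    obtain z t where zt: "q = (z, t)"
      by (cases q)
    have z: "z \<in> ball z0 \<rho>" and t: "t \<in> J"
      using q SJ by (auto simp: zt)
    have "q \<in> \<Omega>"
      using q SJ sub by (auto simp: J_def)
    then obtain \<delta> where \<delta>: "\<delta> > 0" "\<And>x. \<lbrakk>x \<in> \<Omega>; dist x q < \<delta>\<rbrakk> \<Longrightarrow> dist (u x) (u q) < e"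
      using hconvex_fun_continuous_on[OF \<Omega> u] e unfolding continuous_on_iff by metis
    have "\<forall>\<^sub>F k in at_top. k \<ge> max 0 (2 * M / \<delta>)"
      by (rule eventually_ge_at_top)
    then show ?thesis
    proof eventually_elim
      case (elim k)
      then have k: "0 \<le> k" "2 * M \<le> k * \<delta>"
        using \<delta>(1) by (auto simp: field_simps)
      show ?case
        unfolding zt
      proof (rule U_least)
        fix t' assume t': "t' \<in> J"
        show "u (z, t') - k * \<bar>t - t'\<bar> \<le> u (z, t) + e"
        proof (cases "\<bar>t - t'\<bar> < \<delta>")
          case True
          have "(z, t') \<in> \<Omega>"
            using z t' sub by (auto simp: J_def)
          moreover have "dist (z, t') q < \<delta>"
            using True by (simp add: zt dist_Pair_Pair dist_real_def abs_minus_commute)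
          ultimately have "dist (u (z, t')) (u q) < e"
            by (rule \<delta>(2))
          moreover have "0 \<le> k * \<bar>t - t'\<bar>"
            using k by simp
          ultimately show ?thesis
            unfolding zt dist_real_def by linarith
        next
          case False
          then have "k * \<delta> \<le> k * \<bar>t - t'\<bar>"
            using k(1) by (intro mult_left_mono) auto
          then show ?thesis
            using uM[OF z t'] uM[OF z t] k(2) e by linarith
        qed
      qed
    qed
  qed
  have S: "open S" "(z0, t0) \<in> S"
    using \<sigma> by (auto simp: S_def intro: open_Times)
  show ?thesis
  proof (rule field_le_epsilon)
    fix e :: real assume e: "0 < e"
    have "\<forall>\<^sub>F k in at_top. k \<ge> max 0 (2 * M / \<sigma>)"
      by (rule eventually_ge_at_top)
    moreover have "\<forall>\<^sub>F k in at_top. \<forall>i\<in>I. U k (hlift (z0, t0) (w i)) \<le> u (hlift (z0, t0) (w i)) + e"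
      using I(1) w(2) e by (intro eventually_ball_finite ballI U_approx) (auto simp: S_def)
    ultimately have "\<exists>k. k \<ge> max 0 (2 * M / \<sigma>) \<and>
        (\<forall>i\<in>I. U k (hlift (z0, t0) (w i)) \<le> u (hlift (z0, t0) (w i)) + e)"
      by (intro eventually_happens'[OF trivial_limit_at_top_linorder] eventually_conj)
    then obtain k where k: "k \<ge> max 0 (2 * M / \<sigma>)"
      and Uk: "\<And>i. i \<in> I \<Longrightarrow> U k (hlift (z0, t0) (w i)) \<le> u (hlift (z0, t0) (w i)) + e"
      by blast
    have k': "0 \<le> k" "2 * M \<le> k * \<sigma>"
      using k \<sigma>(2) by (auto simp: field_simps)
    have "u (z0, t0) \<le> U k (z0, t0)"
      using \<sigma> k' by (intro U_ge) (auto simp: J_def)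
    also have "\<dots> \<le> (\<Sum>i\<in>I. c i * U k (hlift (z0, t0) (w i)))"
    proof (rule hconvex_fun_jensen_lipschitz[OF S(1) U_hconvex[OF k'] S(2)])
      show "U k (z, t) \<le> U k (z, t') + k * \<bar>t - t'\<bar>" if "(z, t) \<in> S" "(z, t') \<in> S" for z t t'
        using that k' by (intro U_lip) (auto simp: S_def)
    qed (use I w in \<open>auto simp: S_def\<close>)
    also have "\<dots> \<le> (\<Sum>i\<in>I. c i * (u (hlift (z0, t0) (w i)) + e))"
      using I(2) Uk by (intro sum_mono mult_left_mono) auto
    also have "\<dots> = (\<Sum>i\<in>I. c i * u (hlift (z0, t0) (w i))) + e"
      using I(3) by (simp add: distrib_left sum.distrib flip: sum_distrib_right)
    finally show "u (z0, t0) \<le> (\<Sum>i\<in>I. c i * u (hlift (z0, t0) (w i))) + e" .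
  qed
qed

text \<open>Contract all points towards p by a factor \<kappa> until they fit into a box where the
  local version applies; the average stays at p. Convexity along the rays from p bounds the
  contracted values by (1 - \<kappa>) \<open>u p\<close> plus \<kappa> times the original ones, and
  the multiple of \<open>u p\<close> cancels.\<close>

lemma hconvex_fun_jensen:
  fixes u :: "'n::finite heis \<Rightarrow> real" and w :: "'i \<Rightarrow> (real^'n) \<times> (real^'n)"
  assumes \<Omega>: "open \<Omega>" and u: "hconvex_fun \<Omega> u" and p: "p \<in> \<Omega>"
    and I: "finite I" "\<And>i. i \<in> I \<Longrightarrow> 0 \<le> c i" "sum c I = 1"
    and w: "(\<Sum>i\<in>I. c i *\<^sub>R w i) = fst p" "\<And>i. i \<in> I \<Longrightarrow> hlift p (w i) \<in> \<Omega>"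
  shows "u p \<le> (\<Sum>i\<in>I. c i * u (hlift p (w i)))"
proof -
  obtain z0 t0 where p_eq: "p = (z0, t0)"
    by (cases p)
  have "((\<lambda>q. \<bar>u q\<bar>) \<longlongrightarrow> \<bar>u p\<bar>) (nhds p)"
    using hconvex_fun_continuous_on[OF \<Omega> u] \<Omega> p
    by (intro tendsto_rabs) (simp add: continuous_on_eq_continuous_at isCont_def tendsto_nhds_iff)
  then have "\<forall>\<^sub>F q in nhds p. \<bar>u q\<bar> < \<bar>u p\<bar> + 1"
    by (rule order_tendstoD) simp
  moreover have "\<forall>\<^sub>F q in nhds p. q \<in> \<Omega>"
    using \<Omega> p by (rule eventually_nhds_in_open)
  ultimately have "\<forall>\<^sub>F q in nhds p. q \<in> \<Omega> \<and> \<bar>u q\<bar> < \<bar>u p\<bar> + 1"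
    by eventually_elim simp
  then obtain V where V: "open V" "(z0, t0) \<in> V" "\<And>q. q \<in> V \<Longrightarrow> q \<in> \<Omega> \<and> \<bar>u q\<bar> < \<bar>u p\<bar> + 1"
    unfolding eventually_nhds p_eq by blast
  obtain A B where AB: "open A" "open B" "z0 \<in> A" "t0 \<in> B" "A \<times> B \<subseteq> V"
    using V(1,2) by (metis open_prod_elim mem_Times_iff fst_conv snd_conv)
  obtain \<rho> where \<rho>: "\<rho> > 0" "ball z0 \<rho> \<subseteq> A"
    using AB open_contains_ball by metis
  obtain \<sigma>2 where \<sigma>2: "\<sigma>2 > 0" "cball t0 \<sigma>2 \<subseteq> B"
    using AB open_contains_cball by metis
  define \<sigma> where "\<sigma> = \<sigma>2 / 2"
  have \<sigma>: "\<sigma> > 0" "cball t0 (2 * \<sigma>) \<subseteq> B"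
    using \<sigma>2 by (simp_all add: \<sigma>_def)
  have sub: "ball z0 \<rho> \<times> cball t0 (2 * \<sigma>) \<subseteq> V"
    using Sigma_mono[OF \<rho>(2) \<sigma>(2)] AB(5) by (rule order_trans)
  define w' where "w' = (\<lambda>\<kappa> i. (1 - \<kappa>) *\<^sub>R z0 + \<kappa> *\<^sub>R w i)"
  have "\<forall>\<^sub>F \<kappa> in at_right 0. hlift p (w' \<kappa> i) \<in> ball z0 \<rho> \<times> ball t0 \<sigma>" for i
  proof -
    have "((\<lambda>\<kappa>. hlift p (w' \<kappa> i)) \<longlongrightarrow> hlift p ((1 - 0) *\<^sub>R z0 + 0 *\<^sub>R w i)) (at_right 0)"
      unfolding w'_def by (intro tendsto_intros)
    moreover have "hlift p ((1 - 0) *\<^sub>R z0 + 0 *\<^sub>R w i) = (z0, t0)"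
      by (simp add: p_eq hlift_def)
    ultimately have lim: "((\<lambda>\<kappa>. hlift p (w' \<kappa> i)) \<longlongrightarrow> (z0, t0)) (at_right 0)"
      by simp
    show ?thesis
      using \<rho>(1) \<sigma>(1) by (intro topological_tendstoD[OF lim] open_Times) auto
  qed
  then have "\<forall>\<^sub>F \<kappa> in at_right 0. \<forall>i\<in>I. hlift p (w' \<kappa> i) \<in> ball z0 \<rho> \<times> ball t0 \<sigma>"
    using I(1) by (intro eventually_ball_finite) auto
  moreover have "\<forall>\<^sub>F \<kappa> in at_right (0::real). 0 < \<kappa> \<and> \<kappa> < 1"
    by (auto simp: eventually_at_right_field intro!: exI[of _ 1])
  ultimately have "\<forall>\<^sub>F \<kappa> in at_right 0. (0 < \<kappa> \<and> \<kappa> < 1) \<and> (\<forall>i\<in>I. hlift p (w' \<kappa> i) \<in> ball z0 \<rho> \<times> ball t0 \<sigma>)"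
    by eventually_elim blast
  then obtain \<kappa> where \<kappa>: "0 < \<kappa>" "\<kappa> < 1" "\<And>i. i \<in> I \<Longrightarrow> hlift p (w' \<kappa> i) \<in> ball z0 \<rho> \<times> ball t0 \<sigma>"
    using eventually_happens'[OF trivial_limit_at_right_real] by blast
  have sum_w': "(\<Sum>i\<in>I. c i *\<^sub>R w' \<kappa> i) = z0"
  proof -
    have "(\<Sum>i\<in>I. c i *\<^sub>R w' \<kappa> i) = (\<Sum>i\<in>I. c i *\<^sub>R ((1 - \<kappa>) *\<^sub>R z0)) + (\<Sum>i\<in>I. \<kappa> *\<^sub>R (c i *\<^sub>R w i))"
      unfolding w'_def scaleR_add_right sum.distrib by (simp add: mult.commute)
    also have "\<dots> = (1 - \<kappa>) *\<^sub>R z0 + \<kappa> *\<^sub>R z0"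
      using I(3) w(1) unfolding scaleR_left.sum[symmetric] scaleR_right.sum[symmetric] by (simp add: p_eq)
    also have "\<dots> = z0"
      by (simp add: algebra_simps)
    finally show ?thesis .
  qed
  have "u p \<le> (\<Sum>i\<in>I. c i * u (hlift p (w' \<kappa> i)))"
    unfolding p_eq
  proof (rule hconvex_fun_jensen_local[OF \<Omega> u _ \<rho>(1) \<sigma>(1)])
    show "ball z0 \<rho> \<times> cball t0 (2 * \<sigma>) \<subseteq> \<Omega>"
      using sub V(3) by blast
    show "\<bar>u q\<bar> \<le> \<bar>u p\<bar> + 1" if "q \<in> ball z0 \<rho> \<times> cball t0 (2 * \<sigma>)" for q
      using V(3)[OF subsetD[OF sub that]] by simp
  qed (use I sum_w' \<kappa>(3) in \<open>simp_all add: p_eq\<close>)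
  also have "\<dots> \<le> (\<Sum>i\<in>I. c i * ((1 - \<kappa>) * u p + \<kappa> * u (hlift p (w i))))"
  proof (intro sum_mono mult_left_mono)
    fix i assume i: "i \<in> I"
    show "u (hlift p (w' \<kappa> i)) \<le> (1 - \<kappa>) * u p + \<kappa> * u (hlift p (w i))"
      using hconvex_fun_ray[OF u p w(2)[OF i], of \<kappa>] \<kappa> by (simp add: w'_def p_eq)
  qed (rule I(2))
  also have "\<dots> = (1 - \<kappa>) * u p + \<kappa> * (\<Sum>i\<in>I. c i * u (hlift p (w i)))"
  proof -
    have "(\<Sum>i\<in>I. c i * ((1 - \<kappa>) * u p + \<kappa> * u (hlift p (w i))))
        = (\<Sum>i\<in>I. c i * ((1 - \<kappa>) * u p)) + (\<Sum>i\<in>I. \<kappa> * (c i * u (hlift p (w i))))"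
      unfolding distrib_left sum.distrib by (simp add: ac_simps)
    then show ?thesis
      using I(3) unfolding sum_distrib_right[symmetric] sum_distrib_left[symmetric] by simp
  qed
  finally have "\<kappa> * u p \<le> \<kappa> * (\<Sum>i\<in>I. c i * u (hlift p (w i)))"
    by (simp add: algebra_simps)
  then show ?thesis
    using \<kappa>(1) by simp
qed

section \<open>Compact slices and the fixed point argument\<close>

lemma norm_fst_le_gaugeN: "norm (fst q) \<le> gaugeN q"
proof (cases "fst q = 0")
  case True
  then show ?thesis
    by (simp add: gaugeN_def)
next
  case False
  then have "norm (fst q) = (norm (fst q) powr 4) powr (1/4)"
    unfolding powr_powr by simp
  also have "norm (fst q) powr 4 = norm (fst q) ^ 4"
    using False by simp
  also have "(norm (fst q) ^ 4) powr (1/4) \<le> gaugeN q"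
    unfolding gaugeN_def by (intro powr_mono2) auto
  finally show ?thesis .
qed

text \<open>The point p lies in its own plane, and the gauge distance to p dominates the Euclidean
  distance of the projections.\<close>

lemma horiz_bounded_imp_bounded:
  assumes "horiz_bounded \<Omega>" and p: "p \<in> \<Omega>"
  shows "bounded {z. hlift p z \<in> \<Omega>}"
proof -
  define s where "s = (SUP p \<in> \<Omega>. diamH (\<Omega> \<inter> hplane p))"
  have "s < \<infinity>"
    using assms by (simp add: horiz_bounded_def s_def)
  then obtain D :: real where D: "s \<le> ereal D"
    by (cases s) auto
  have "dist (fst p) z \<le> D" if z: "hlift p z \<in> \<Omega>" for z
  proof -
    have "p \<in> hplane p"
      by (simp add: hplane_iff)
    then have "ereal (dH (hlift p z) p) \<le> diamH (\<Omega> \<inter> hplane p)"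
      unfolding diamH_def using z p by (intro SUP_upper2[of "(hlift p z, p)"]) auto
    also have "\<dots> \<le> s"
      unfolding s_def using p by (rule SUP_upper)
    also note D
    finally have "dH (hlift p z) p \<le> D"
      by simp
    moreover have "norm (fst (hinv p \<circ>\<^sub>H hlift p z)) \<le> dH (hlift p z) p"
      unfolding dH_def by (rule norm_fst_le_gaugeN)
    ultimately show ?thesis
      by (simp add: hmult_def hinv_def dist_norm norm_minus_commute)
  qed
  then show ?thesis
    unfolding bounded_def by blast
qed

lemma hconvex_fun_horizontal_min_exists:
  fixes \<Omega> \<Omega>0 :: "'n::finite heis set" and u :: "'n heis \<Rightarrow> real"
  assumes \<Omega>: "open \<Omega>" "horiz_bounded \<Omega>" and u: "hconvex_fun \<Omega> u"
    and \<Omega>0: "open \<Omega>0" "closure \<Omega>0 \<subseteq> \<Omega>"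
    and \<xi>: "\<xi> \<in> \<Omega>0" and front: "\<And>q. \<lbrakk>q \<in> frontier \<Omega>0; q \<in> hplane \<xi>\<rbrakk> \<Longrightarrow> u \<xi> < u q"
  shows "\<exists>\<eta>\<in>\<Omega>0. \<forall>q\<in>\<Omega> \<inter> hplane \<eta>. u \<eta> \<le> u q"
proof (rule ccontr)
  assume "\<not> ?thesis"
  then have descent: "\<exists>q \<in> \<Omega> \<inter> hplane \<eta>. u q < u \<eta>" if "\<eta> \<in> \<Omega>0" for \<eta>
    using that by (auto simp: not_le)
  define h where "h = hlift \<xi>"
  define z0 where "z0 = fst \<xi>"
  define K where "K = {z. h z \<in> closure \<Omega>0}"
  define U where "U = (\<lambda>a. {z. h z \<in> \<Omega> \<and> hlift (h z) a \<in> \<Omega> \<and> u (hlift (h z) a) < u (h z)})"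
  define V where "V = (\<lambda>a. U a \<inter> h -` \<Omega>0)"
  \<comment> \<open>K need not be convex, so Brouwer's theorem is not applied to it. Adding the
    complement of K to the set with target z0 makes the cover one of the whole space. The sets
    \<open>V a\<close> lie inside K, so off K every active target is z0; a fixed point there would
    be z0 itself, which belongs to K.\<close>
  define V0 where "V0 = U z0 \<union> - K"
  have cont_h: "continuous_on T h" for T
    unfolding h_def by (intro continuous_intros)
  have cont_u: "continuous_on \<Omega> u"
    using \<Omega>(1) u by (rule hconvex_fun_continuous_on)
  have cl: "q \<in> \<Omega>0 \<Longrightarrow> q \<in> closure \<Omega>0" "q \<in> closure \<Omega>0 \<Longrightarrow> q \<in> \<Omega>" for q
    using closure_subset[of \<Omega>0] \<Omega>0(2) by auto
  have \<xi>\<Omega>: "\<xi> \<in> \<Omega>"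
    by (intro cl \<xi>)
  have h_z0: "h z0 = \<xi>"
    by (simp add: h_def z0_def)
  have open_U: "open (U a)" for a
  proof -
    define D where "D = h -` \<Omega> \<inter> (\<lambda>z. hlift (h z) a) -` \<Omega>"
    have cont_a: "continuous_on T (\<lambda>z. hlift (h z) a)" for T
      by (intro continuous_intros cont_h)
    have "open D"
      unfolding D_def by (intro open_Int open_vimage[OF \<Omega>(1)] cont_h cont_a)
    moreover have "continuous_on D (\<lambda>z. u (h z) - u (hlift (h z) a))"
      by (intro continuous_intros continuous_on_compose2[OF cont_u cont_h] continuous_on_compose2[OF cont_u cont_a])
        (auto simp: D_def)
    ultimately have "open (D \<inter> (\<lambda>z. u (h z) - u (hlift (h z) a)) -` {0<..})"
      by (intro continuous_open_preimage) auto
    also have "D \<inter> (\<lambda>z. u (h z) - u (hlift (h z) a)) -` {0<..} = U a"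
      by (auto simp: D_def U_def)
    finally show ?thesis .
  qed
  have "closed K"
    using closed_vimage[OF closed_closure cont_h] by (simp add: K_def vimage_def)
  moreover have "bounded K"
    using horiz_bounded_imp_bounded[OF \<Omega>(2) \<xi>\<Omega>] by (rule bounded_subset) (auto simp: K_def h_def intro: cl(2))
  ultimately have "compact K"
    by (simp add: compact_eq_bounded_closed)
  have open_V: "open (V a)" for a
    unfolding V_def by (intro open_Int open_U open_vimage[OF \<Omega>0(1)] cont_h)
  have open_V0: "open V0"
    unfolding V0_def using open_U \<open>closed K\<close> by (intro open_Un) auto
  have cover: "K - V0 \<subseteq> (\<Union>a\<in>UNIV. V a)"
  proof
    fix z assume z: "z \<in> K - V0"
    show "z \<in> (\<Union>a\<in>UNIV. V a)"
    proof (cases "h z \<in> \<Omega>0")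
      case True
      then obtain q where q: "q \<in> \<Omega>" "q \<in> hplane (h z)" "u q < u (h z)"
        using descent by blast
      have "hlift (h z) (fst q) = q"
        using q(2) unfolding hplane_iff by (rule sym)
      then have "z \<in> V (fst q)"
        using q True cl(2)[OF cl(1)[OF True]] by (simp add: V_def U_def)
      then show ?thesis
        by blast
    next
      case False
      then have "h z \<in> frontier \<Omega>0"
        using z \<Omega>0(1) by (simp add: V0_def K_def frontier_def interior_open)
      then have "u \<xi> < u (h z)"
        by (rule front) (simp add: h_def)
      moreover have "hlift (h z) z0 = \<xi>"
        unfolding h_def z0_def by (rule hlift_hlift(2)[where r = 1 and a = z]) simp
      ultimately have "z \<in> U z0"
        using z cl(2)[of "h z"] \<xi>\<Omega> by (simp add: U_def V0_def K_def)
      then show ?thesis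
        using z by (simp add: V0_def)
    qed
  qed
  have "compact (K - V0)"
    using \<open>compact K\<close> open_V0 by (rule compact_diff)
  then obtain B where B: "finite B" "K - V0 \<subseteq> (\<Union>a\<in>B. V a)"
    by (rule compactE_image[OF _ open_V cover])
  define \<C> where "\<C> = insert V0 (V ` B)"
  have fin: "finite \<C>"
    using B(1) by (simp add: \<C>_def)
  have cov: "UNIV \<subseteq> \<Union>\<C>"
  proof
    fix z :: "(real^'n) \<times> (real^'n)"
    show "z \<in> \<Union>\<C>"
    proof (cases "z \<in> V0")
      case False
      then have "z \<in> K - V0"
        by (simp add: V0_def)
      then show ?thesis
        using B(2) unfolding \<C>_def by blast
    qed (simp add: \<C>_def)
  qed
  \<comment> \<open>The partition of unity is indexed by the sets in \<open>\<C>\<close>, and one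
    set may be \<open>V a\<close> for several a. A target is therefore chosen for each set by its
    property.\<close>
  have "\<exists>a. \<forall>z\<in>T. (z \<in> K \<longrightarrow> z \<in> U a) \<and> (z \<notin> K \<longrightarrow> a = z0)" if T: "T \<in> \<C>" for T
  proof (cases "T = V0")
    case True
    then show ?thesis
      by (intro exI[of _ z0]) (auto simp: V0_def)
  next
    case False
    then obtain a where "T = V a"
      using T unfolding \<C>_def by blast
    then show ?thesis
      using cl(1) unfolding V_def K_def by (intro exI[of _ a]) blast
  qed
  then have "\<forall>T\<in>\<C>. \<exists>a. \<forall>z\<in>T. (z \<in> K \<longrightarrow> z \<in> U a) \<and> (z \<notin> K \<longrightarrow> a = z0)"
    by (rule ballI)
  then obtain \<tau> where "\<forall>T\<in>\<C>. \<forall>z\<in>T. (z \<in> K \<longrightarrow> z \<in> U (\<tau> T)) \<and> (z \<notin> K \<longrightarrow> \<tau> T = z0)"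
    by (rule bchoice[THEN exE])
  then have \<tau>: "\<And>T z. \<lbrakk>T \<in> \<C>; z \<in> T; z \<in> K\<rbrakk> \<Longrightarrow> z \<in> U (\<tau> T)"
      "\<And>T z. \<lbrakk>T \<in> \<C>; z \<in> T; z \<notin> K\<rbrakk> \<Longrightarrow> \<tau> T = z0"
    by blast+
  obtain F :: "((real^'n) \<times> (real^'n)) set \<Rightarrow> (real^'n) \<times> (real^'n) \<Rightarrow> real"
    where F1: "\<And>T. T \<in> \<C> \<Longrightarrow> continuous_on UNIV (F T) \<and> (\<forall>x\<in>UNIV. 0 \<le> F T x)"
      and F2: "\<And>x T. \<lbrakk>T \<in> \<C>; x \<in> UNIV; x \<notin> T\<rbrakk> \<Longrightarrow> F T x = 0"
      and F3: "\<And>x. x \<in> UNIV \<Longrightarrow> supp_sum (\<lambda>T. F T x) \<C> = 1"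
  proof (rule subordinate_partition_of_unity[OF cov])
    show "open T" if "T \<in> \<C>" for T
      using that open_V open_V0 by (auto simp: \<C>_def)
    show "\<exists>V. open V \<and> x \<in> V \<and> finite {U \<in> \<C>. U \<inter> V \<noteq> {}}" for x
      using fin by (intro exI[of _ UNIV]) auto
  qed blast
  have F_nonneg: "0 \<le> F T x" if "T \<in> \<C>" for T x
    using F1[OF that] by blast
  have F_sum: "(\<Sum>T\<in>\<C>. F T x) = 1" for x
  proof -
    have "(\<Sum>T\<in>\<C>. F T x) = (\<Sum>T | T \<in> \<C> \<and> F T x \<noteq> 0. F T x)"
      by (rule sum.mono_neutral_right[OF fin]) auto
    also have "\<dots> = 1"
      using F3[of x] by (simp add: supp_sum_def support_on_def)
    finally show ?thesis .
  qed
  define g where "g = (\<lambda>x. \<Sum>T\<in>\<C>. F T x *\<^sub>R \<tau> T)"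
  obtain x where x: "g x = x"
  \<comment> \<open>The averages lie in the hull of finitely many targets. This hull may leave K,
    which is harmless because g is defined everywhere.\<close>
  proof (rule brouwer)
    show "compact (convex hull (\<tau> ` \<C>))"
      using fin by (simp add: finite_imp_compact_convex_hull)
    show "convex hull (\<tau> ` \<C>) \<noteq> {}"
      by (simp add: \<C>_def)
    show "continuous_on (convex hull (\<tau> ` \<C>)) g"
      unfolding g_def
      by (intro continuous_on_sum continuous_on_scaleR continuous_on_const F1[THEN conjunct1, THEN continuous_on_subset])
        simp_all
    show "g \<in> convex hull (\<tau> ` \<C>) \<rightarrow> convex hull (\<tau> ` \<C>)"
    proof
      fix y
      show "g y \<in> convex hull (\<tau> ` \<C>)"
        unfolding g_def
      proof (rule convex_sum[OF fin convex_convex_hull F_sum])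
        show "0 \<le> F T y" if "T \<in> \<C>" for T
          using that by (rule F_nonneg)
        show "\<tau> T \<in> convex hull (\<tau> ` \<C>)" if "T \<in> \<C>" for T
          using that by (intro hull_inc imageI)
      qed
    qed
  qed simp_all
  \<comment> \<open>A set of positive weight at x contains x, so its target is a descent target for
    x. The other targets are dropped, since their lifts from \<open>h x\<close> need not even lie in
    \<Omega>, as Jensen's inequality requires.\<close>
  define I where "I = {T \<in> \<C>. F T x \<noteq> 0}"
  have "x \<in> T \<and> 0 < F T x" if "T \<in> \<C>" "F T x \<noteq> 0" for T
    using F2[of T x] F_nonneg[of T x] that by fastforce
  then have I: "finite I" "\<And>T. T \<in> I \<Longrightarrow> T \<in> \<C> \<and> x \<in> T \<and> 0 < F T x"
    using fin by (simp_all add: I_def)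
  have "(\<Sum>T\<in>\<C>. F T x) = (\<Sum>T\<in>I. F T x)"
    by (rule sum.mono_neutral_right[OF fin]) (auto simp: I_def)
  then have I_sum: "(\<Sum>T\<in>I. F T x) = 1"
    using F_sum[of x] by simp
  have "(\<Sum>T\<in>\<C>. F T x *\<^sub>R \<tau> T) = (\<Sum>T\<in>I. F T x *\<^sub>R \<tau> T)"
    by (rule sum.mono_neutral_right[OF fin]) (auto simp: I_def)
  then have I_x: "(\<Sum>T\<in>I. F T x *\<^sub>R \<tau> T) = x"
    using x unfolding g_def by (rule trans[OF sym])
  have "x \<in> K"
  proof (rule ccontr)
    assume "x \<notin> K"
    then have "\<tau> T = z0" if "T \<in> I" for T
      using I(2)[OF that] \<tau>(2) by blast
    then have "(\<Sum>T\<in>I. F T x *\<^sub>R \<tau> T) = (\<Sum>T\<in>I. F T x *\<^sub>R z0)"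
      by simp
    also have "\<dots> = z0"
      using I_sum unfolding scaleR_left.sum[symmetric] by simp
    finally have "x = z0"
      using I_x by simp
    then show False
      using \<open>x \<notin> K\<close> h_z0 cl(1)[OF \<xi>] by (simp add: K_def)
  qed
  then have xU: "x \<in> U (\<tau> T)" if "T \<in> I" for T
    using \<tau>(1) I(2)[OF that] by blast
  have "u (h x) \<le> (\<Sum>T\<in>I. F T x * u (hlift (h x) (\<tau> T)))"
  proof (rule hconvex_fun_jensen[OF \<Omega>(1) u _ I(1) _ I_sum])
    show "h x \<in> \<Omega>"
      using \<open>x \<in> K\<close> by (simp add: K_def cl(2))
    show "(\<Sum>T\<in>I. F T x *\<^sub>R \<tau> T) = fst (h x)"
      by (simp add: I_x h_def)
    show "0 \<le> F T x" if "T \<in> I" for T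
      using I(2)[OF that] by simp
    show "hlift (h x) (\<tau> T) \<in> \<Omega>" if "T \<in> I" for T
      using xU[OF that] by (simp add: U_def)
  qed
  also have "\<dots> < (\<Sum>T\<in>I. F T x * u (h x))"
  proof (rule sum_strict_mono[OF I(1)])
    show "I \<noteq> {}"
      using I_sum by auto
    show "F T x * u (hlift (h x) (\<tau> T)) < F T x * u (h x)" if "T \<in> I" for T
      using I(2)[OF that] xU[OF that] by (simp add: U_def)
  qed
  also have "\<dots> = u (h x)"
    using I_sum by (simp flip: sum_distrib_right)
  finally show False
    by simp
qed

theorem theorem1p1:
  fixes \<Omega> \<Omega>0 :: "'n::finite heis set" and u v :: "'n heis \<Rightarrow> real"
  assumes "open \<Omega>" and "horiz_bounded \<Omega>" and "hconvex_set \<Omega>"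
    and "hconvex_fun \<Omega> u" and "hconvex_fun \<Omega> v"
    and "open \<Omega>0" and "closure \<Omega>0 \<subseteq> \<Omega>"
    and "\<forall>p\<in>\<Omega>0. u p < v p"
    and "\<forall>p\<in>frontier \<Omega>0. u p = v p"
  shows "hsubdiff_set \<Omega> v \<Omega>0 \<subseteq> hsubdiff_set \<Omega> u \<Omega>0"
proof
  fix P assume "P \<in> hsubdiff_set \<Omega> v \<Omega>0"
  then obtain \<xi> where \<xi>: "\<xi> \<in> \<Omega>0"
    and v: "\<And>q. q \<in> \<Omega> \<inter> hplane \<xi> \<Longrightarrow> v q \<ge> v \<xi> + P \<bullet> (fst q - fst \<xi>)"
    by (auto simp: hsubdiff_set_def hsubdiff_def Pr1_def)
  define W where "W = (\<lambda>q. u q + (- P) \<bullet> fst q)"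
  have W: "hconvex_fun \<Omega> W"
    unfolding W_def using assms(4) by (rule hconvex_fun_add_linear)
  have "W \<xi> < W q" if q: "q \<in> frontier \<Omega>0" "q \<in> hplane \<xi>" for q
  proof -
    have "q \<in> \<Omega>"
      using q(1) assms(7) by (auto simp: frontier_def)
    then have "v q \<ge> v \<xi> + P \<bullet> (fst q - fst \<xi>)"
      using v q(2) by blast
    moreover have "u q = v q" "u \<xi> < v \<xi>"
      using assms(8,9) q(1) \<xi> by auto
    ultimately show ?thesis
      by (simp add: W_def inner_diff_right)
  qed
  then obtain \<eta> where \<eta>: "\<eta> \<in> \<Omega>0" "\<And>q. q \<in> \<Omega> \<inter> hplane \<eta> \<Longrightarrow> W \<eta> \<le> W q"
    using hconvex_fun_horizontal_min_exists[OF assms(1,2) W assms(6,7) \<xi>] by blast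
  have "P \<in> hsubdiff \<Omega> u \<eta>"
    using \<eta>(2) by (fastforce simp: hsubdiff_def Pr1_def W_def inner_diff_right)
  then show "P \<in> hsubdiff_set \<Omega> u \<Omega>0"
    using \<eta>(1) by (auto simp: hsubdiff_set_def)
qed

end
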